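(* Let $n\ge 2$, $c\in\mathbb{Z}_+^n$, and let $K=K(c)$ be the $A_n$-crystal with parameter $c$. Let $a\in\mathcal{B}(c)$, let $K^{\uparrow}[a]$ be the upper subcrystal of $K$ containing the principal vertex $\pi[a]$, let $h^{\uparrow}$ be the coordinate of $\pi[a]$ in the principal lattice $\Pi^{\uparrow}[a]$ of $K^{\uparrow}[a]$, and let $\Delta=(\Delta_1,\ldots,\Delta_{n-1})$ be such that $h^{\uparrow}+\Delta$ is the coordinate of a vertex $v$ of $\Pi^{\uparrow}[a]$. Let $\tilde K$ be the middle subcrystal of $K$ containing $v$ and let $K^{\downarrow}[b]$, $b\in\mathcal{B}(c)$, be the lower subcrystal of $K$ containing $\tilde K$. Then, setting $\Delta_0=\Delta_n:=0$, $$b_i=a_i+\Delta_i^{+}+\Delta_{i-1}^{-},\qquad i=1,\ldots,n,$$ where $x^+=\max\{0,x\}$ and $x^-=\min\{0,x\}$.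
   Context: An $A_n$-crystal is a (regular, finite, connected) crystal graph of type $A_n$: a directed graph whose edges are colored $1,\ldots,n$, equivalently the Kashiwara crystal graph of an irreducible integrable highest-weight $U_q(\mathfrak{sl}_{n+1})$-module, where an $i$-colored edge $(u,v)$ means $v=F_i(u)$ for the (partial, invertible) lowering operator $F_i$. Each monochromatic connected component of color $i$ is a directed path. Such a crystal has a unique source $s_K$ (zero indegree); for $c\in\mathbb{Z}_+^n$, $K(c)$ denotes the unique $A_n$-crystal in which the maximal $i$-colored path starting at the source has length $c_i$ for every $i$. A subcrystal with color set $I$ means a maximal connected subgraph whose edges have colors in $I$; with colors $\{i,\dots,j\}$ it is itself an $A$-crystal (relabel colors $i,\dots,j$ as $1,\dots,j-i+1$). Principal lattice: let $\mathcal{B}(c)=\{a\in\mathbb{Z}^n:0\le a\le c\}$. For $1\le k\le n$ let $S_{n,k}=w_{n,k,n-k+1}\cdots w_{n,k,2}w_{n,k,1}$ with $w_{n,k,j}=F_jF_{j+1}\cdots F_{j+k-1}$ (operators applied right to left). The principal vertex at $a\in\mathcal{B}(c)$ is $\pi[a]=S_{n,n}^{a_n}\cdots S_{n,1}^{a_1}(s_K)$ (all operators applicable; distinct $a$ give distinct vertices). For an $A_{n-1}$-crystal with colors $1,\dots,n-1$ the principal lattice is defined the same way with $n-1$ in place of $n$, with coordinates $p=(p_1,\dots,p_{n-1})$. Upper subcrystals are the subcrystals of $K$ with colors $1,\ldots,n-1$; lower subcrystals those with colors $2,\ldots,n$; middle subcrystals those with colors $2,\ldots,n-1$. It is known that each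 upper (resp. lower) subcrystal contains exactly one principal vertex of $K$; $K^{\uparrow}[a]$ (resp. $K^{\downarrow}[b]$) denotes the upper (resp. lower) subcrystal containing $\pi[a]$ (resp. $\pi[b]$). Moreover $K^{\uparrow}[a]\cong K(c^{\uparrow})$ with $c^{\uparrow}_i=c_i-a_i+a_{i+1}$, and the coordinate of $\pi[a]$ in $\Pi^{\uparrow}[a]$ is $h^{\uparrow}=(a_2,\ldots,a_n)$. Every middle subcrystal lies in exactly one lower subcrystal. *)

theory Defs
  imports Main
begin

record 'v cgraph =
  verts :: "'v set"
  arcs :: "nat \<Rightarrow> ('v \<times> 'v) set"

definition contained_in :: "'v cgraph \<Rightarrow> 'v cgraph \<Rightarrow> bool" where
  "contained_in G H \<longleftrightarrow> verts G \<subseteq> verts H \<and> (\<forall>i. arcs G i \<subseteq> arcs H i)"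

text \<open>
  Connectedness disregards the direction of edges. A subcrystal is the maximal connected subgraph
  with colors in \<open>I\<close> through a given vertex; colors are not relabeled.
\<close>

definition component :: "'v cgraph \<Rightarrow> nat set \<Rightarrow> 'v \<Rightarrow> 'v set" where
  "component K I v = {w. (v, w) \<in> (\<Union>i\<in>I. arcs K i \<union> (arcs K i)\<inverse>)\<^sup>*}"

definition subcrystal :: "'v cgraph \<Rightarrow> nat set \<Rightarrow> 'v \<Rightarrow> 'v cgraph" where
  "subcrystal K I v =
    \<lparr>verts = component K I v,
     arcs = (\<lambda>i. if i \<in> I then arcs K i \<inter> (component K I v \<times> component K I v) else {})\<rparr>"

definition is_dipath :: "'v set \<Rightarrow> ('v \<times> 'v) set \<Rightarrow> bool" where
  "is_dipath C E \<longleftrightarrow> (\<exists>p. distinct p \<and> set p = C \<and> E = set (zip p (tl p)))"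

text \<open>
  The relation \<open>arcs K i\<close> is the graph of the partial operator \<open>F\<^sub>i\<close>, and its converse that of
  the inverse operator. The lengths of the parts of the maximal \<open>i\<close>-colored path through \<open>v\<close>
  before and after \<open>v\<close> are \<open>tail_len K i v\<close> and \<open>head_len K i v\<close>.
\<close>

definition tail_len :: "'v cgraph \<Rightarrow> nat \<Rightarrow> 'v \<Rightarrow> nat" where
  "tail_len K i v = (GREATEST k. \<exists>w. (w, v) \<in> arcs K i ^^ k)"

definition head_len :: "'v cgraph \<Rightarrow> nat \<Rightarrow> 'v \<Rightarrow> nat" where
  "head_len K i v = (GREATEST k. \<exists>w. (v, w) \<in> arcs K i ^^ k)"

text \<open>
  For an \<open>i\<close>-edge \<open>(u, v)\<close> and a neighboring color \<open>j\<close> of \<open>i\<close> the label is \<open>0\<close> or \<open>1\<close>: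
  either \<open>tail_len K j\<close> drops by one along the edge, or \<open>head_len K j\<close> grows by one.
\<close>

definition label :: "'v cgraph \<Rightarrow> nat \<Rightarrow> 'v \<Rightarrow> 'v \<Rightarrow> int" where
  "label K j u v = int (head_len K j v) - int (head_len K j u)"

definition neighbors :: "nat \<Rightarrow> nat \<Rightarrow> bool" where
  "neighbors i j \<longleftrightarrow> j = Suc i \<or> i = Suc j"

text \<open>
  Finite connected regular crystal graphs of type A, by Stembridge's local axioms in the form used
  by Danilov, Karzanov and Koshevoy. Relation composition \<open>R O S\<close> applies \<open>R\<close> first.
\<close>

locale A_crystal =
  fixes n :: nat and K :: "'v cgraph"
  assumes finite_verts: "finite (verts K)"
    and nonempty: "verts K \<noteq> {}"
    and arcs_verts: "arcs K i \<subseteq> verts K \<times> verts K"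
    and arc_colors: "i \<notin> {1..n} \<Longrightarrow> arcs K i = {}"
    and connected: "v \<in> verts K \<Longrightarrow> component K {1..n} v = verts K"
    and strings: "\<lbrakk>i \<in> {1..n}; v \<in> verts K\<rbrakk> \<Longrightarrow>
      is_dipath (verts (subcrystal K {i} v)) (arcs (subcrystal K {i} v) i)"
    and tail_antimono: "\<lbrakk>i \<in> {1..n}; j \<in> {1..n}; i \<noteq> j; (u, v) \<in> arcs K i\<rbrakk> \<Longrightarrow>
      tail_len K j v \<le> tail_len K j u"
    and head_mono: "\<lbrakk>i \<in> {1..n}; j \<in> {1..n}; i \<noteq> j; (u, v) \<in> arcs K i\<rbrakk> \<Longrightarrow>
      head_len K j u \<le> head_len K j v"
    and length_change: "\<lbrakk>i \<in> {1..n}; j \<in> {1..n}; i \<noteq> j; (u, v) \<in> arcs K i\<rbrakk> \<Longrightarrow>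
      (tail_len K j u - tail_len K j v) + (head_len K j v - head_len K j u) =
      (if neighbors i j then 1 else 0)"
    and head_convex: "\<lbrakk>i \<in> {1..n}; j \<in> {1..n}; i \<noteq> j; (u, v) \<in> arcs K i; (v, w) \<in> arcs K i\<rbrakk> \<Longrightarrow>
      2 * head_len K j v \<le> head_len K j u + head_len K j w"
    and square_out: "\<lbrakk>i \<in> {1..n}; j \<in> {1..n}; neighbors i j;
        (u, v) \<in> arcs K i; (u, v') \<in> arcs K j; label K j u v = 0\<rbrakk> \<Longrightarrow>
      label K i u v' = 1 \<and> (\<exists>w. (v, w) \<in> arcs K j \<and> (v', w) \<in> arcs K i)"
    and square_in: "\<lbrakk>i \<in> {1..n}; j \<in> {1..n}; neighbors i j;
        (u, v) \<in> arcs K i; (u', v) \<in> arcs K j; label K j u v = 1\<rbrakk> \<Longrightarrow>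
      label K i u' v = 0 \<and> (\<exists>w. (w, u) \<in> arcs K j \<and> (w, u') \<in> arcs K i)"
    and octagon_out: "\<lbrakk>i \<in> {1..n}; j \<in> {1..n}; neighbors i j;
        (u, v) \<in> arcs K i; (u, v') \<in> arcs K j; label K j u v = 1; label K i u v' = 1\<rbrakk> \<Longrightarrow>
      \<exists>w. (u, w) \<in> arcs K i O arcs K j O arcs K j O arcs K i \<and>
          (u, w) \<in> arcs K j O arcs K i O arcs K i O arcs K j"
    and octagon_in: "\<lbrakk>i \<in> {1..n}; j \<in> {1..n}; neighbors i j;
        (u, v) \<in> arcs K i; (u', v) \<in> arcs K j; label K j u v = 0; label K i u' v = 0\<rbrakk> \<Longrightarrow>
      \<exists>w. (w, v) \<in> arcs K i O arcs K j O arcs K j O arcs K i \<and>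
          (w, v) \<in> arcs K j O arcs K i O arcs K i O arcs K j"
    and commute: "\<lbrakk>i \<in> {1..n}; j \<in> {1..n}; i \<noteq> j; \<not> neighbors i j\<rbrakk> \<Longrightarrow>
      arcs K i O arcs K j = arcs K j O arcs K i \<and>
      (arcs K i)\<inverse> O arcs K j = arcs K j O (arcs K i)\<inverse>"

definition source :: "'v cgraph \<Rightarrow> 'v" where
  "source K = (THE s. s \<in> verts K \<and> (\<forall>i u. (u, s) \<notin> arcs K i))"

definition parameter :: "'v cgraph \<Rightarrow> nat \<Rightarrow> nat" where
  "parameter K i = head_len K i (source K)"

text \<open>
  \<open>K\<close> is a representative, with arbitrary vertices, of the isomorphism class \<open>K(c)\<close>. Vectors such
  as \<open>c\<close> are functions of which only the values at \<open>1, \<dots>, n\<close> matter.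
\<close>

definition A_crystal_with :: "nat \<Rightarrow> (nat \<Rightarrow> nat) \<Rightarrow> 'v cgraph \<Rightarrow> bool" where
  "A_crystal_with n c K \<longleftrightarrow> A_crystal n K \<and> (\<forall>i\<in>{1..n}. parameter K i = c i)"

definition box :: "nat \<Rightarrow> (nat \<Rightarrow> nat) \<Rightarrow> (nat \<Rightarrow> int) set" where
  "box n c = {a. \<forall>i\<in>{1..n}. 0 \<le> a i \<and> a i \<le> int (c i)}"

text \<open>
  Below, a list of partial operators is applied from its first element to its last, so the factors
  of a product of operators written on the left of their argument appear in reverse.
\<close>

definition apply_in_order :: "('v \<times> 'v) set list \<Rightarrow> ('v \<times> 'v) set" where
  "apply_in_order rs = foldr (O) rs Id"

text \<open>\<open>F\<^sub>j F\<^bsub>j+1\<^esub> \<dots> F\<^bsub>j+k-1\<^esub>\<close>\<close>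

definition w_op :: "'v cgraph \<Rightarrow> nat \<Rightarrow> nat \<Rightarrow> ('v \<times> 'v) set" where
  "w_op K k j = apply_in_order (map (arcs K) (rev [j..<j + k]))"

text \<open>\<open>w\<^bsub>n,k,n-k+1\<^esub> \<dots> w\<^bsub>n,k,2\<^esub> w\<^bsub>n,k,1\<^esub>\<close>\<close>

definition S_op :: "'v cgraph \<Rightarrow> nat \<Rightarrow> nat \<Rightarrow> ('v \<times> 'v) set" where
  "S_op K n k = apply_in_order (map (w_op K k) [1..<n - k + 2])"

text \<open>\<open>\<pi>[a] = S\<^bsub>n,n\<^esub>\<^bsup>a(n)\<^esup> \<dots> S\<^bsub>n,1\<^esub>\<^bsup>a(1)\<^esup> (s)\<close> for the source \<open>s\<close>\<close>

definition principal_vertex :: "'v cgraph \<Rightarrow> nat \<Rightarrow> (nat \<Rightarrow> int) \<Rightarrow> 'v" where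
  "principal_vertex K n a =
    (THE v. (source K, v) \<in> apply_in_order (map (\<lambda>k. S_op K n k ^^ nat (a k)) [1..<n + 1]))"

definition is_coordinate :: "'v cgraph \<Rightarrow> nat \<Rightarrow> (nat \<Rightarrow> int) \<Rightarrow> 'v \<Rightarrow> bool" where
  "is_coordinate K n a v \<longleftrightarrow> a \<in> box n (parameter K) \<and> principal_vertex K n a = v"

definition upper :: "'v cgraph \<Rightarrow> nat \<Rightarrow> (nat \<Rightarrow> int) \<Rightarrow> 'v cgraph" where
  "upper K n a = subcrystal K {1..n - 1} (principal_vertex K n a)"

definition lower :: "'v cgraph \<Rightarrow> nat \<Rightarrow> (nat \<Rightarrow> int) \<Rightarrow> 'v cgraph" where
  "lower K n b = subcrystal K {2..n} (principal_vertex K n b)"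

end

theory Submission
  imports Defs
begin

text \<open>
  The argument compares string parametrizations. For adjacent colors, the lengths of the climbs
  \<open>i, j, i\<close> and \<open>j, i, j\<close> from any vertex to the source of its \<open>{i, j}\<close>-component determine each other
  by a piecewise linear formula; this follows from the local axioms by induction along the arcs.
  Non-neighboring colors commute.

  The source of the upper subcrystal at \<open>a\<close> is \<open>F\<^sub>n \<dots> F\<^sub>1 s\<close> with exponent \<open>a\<^sub>1 + \<dots> + a\<^sub>k\<close> on \<open>F\<^sub>k\<close>, and
  the source of the lower subcrystal at \<open>b\<close> is \<open>F\<^sub>1 \<dots> F\<^sub>n s\<close> with exponent \<open>b\<^sub>k + \<dots> + b\<^sub>n\<close> on \<open>F\<^sub>k\<close>.
  Applying the latter inside the upper subcrystal, the source of the middle subcrystal of \<open>v\<close> has a known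
  string for the word \<open>1 \<dots> n - 1, n, n - 1 \<dots> 1\<close>. Braid moves carry it to the word
  \<open>n \<dots> 2, 1, 2 \<dots> n\<close>, whose second half is the string of the source of the lower subcrystal
  containing \<open>v\<close>, and \<open>b\<close> is read off from it.
\<close>

lemma neighbors_sym: "neighbors i j \<longleftrightarrow> neighbors j i"
  by (auto simp: neighbors_def)

text \<open>
  The \<open>A\<^sub>2\<close> transition \<open>p = max c (b - a)\<close>, \<open>q = a + c\<close>, \<open>r = min a (b - c)\<close> between strings with \<open>c \<le> b\<close>,
  in a form that avoids subtraction and exhibits the symmetry.
\<close>

definition tropical :: "nat \<Rightarrow> nat \<Rightarrow> nat \<Rightarrow> nat \<Rightarrow> nat \<Rightarrow> nat \<Rightarrow> bool" where
  "tropical a b c p q r \<longleftrightarrow>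
    c \<le> b \<and> q = a + c \<and> b = p + r \<and> (q \<le> b \<and> r = a \<or> b \<le> q \<and> p = c)"

lemma tropical_sym: "tropical a b c p q r \<Longrightarrow> tropical p q r a b c"
  unfolding tropical_def by linarith

lemma tropical_min: "tropical a b c p q r \<Longrightarrow> q = a + c \<and> r = min a (b - c)"
  unfolding tropical_def by linarith

lemma tropical_square:
  assumes "tropical a b c (Suc p) q r" "tropical (Suc a') b' c' p' q' r'" "tropical a' b' c' p q r"
    and "a = a' \<and> Suc p' = p \<or> a' = Suc a \<and> p = p'"
  shows "tropical (Suc a) b c (Suc p') q' r'"
  using assms unfolding tropical_def by linarith

lemma tropical_octagon:
  assumes "tropical a b c (Suc (Suc p)) q r" "tropical (Suc a0) b0 c0 p q r" "tropical a0 b0 c0 p0 q0 r0"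
    "tropical a' b' c' (Suc p0) q0 r0" "tropical (Suc (Suc a')) b' c' p' q' r'"
    and "a' = a" "p = p'"
  shows "tropical (Suc a) b c (Suc p') q' r'"
  using assms unfolding tropical_def by linarith

lemma funpow_commute_of_commute:
  "(\<And>x. g (h x) = h (g x)) \<Longrightarrow> g ((h ^^ t) x) = (h ^^ t) (g x)"
  by (induction t) auto

definition prefix_sum :: "(nat \<Rightarrow> nat) \<Rightarrow> nat \<Rightarrow> nat" where
  "prefix_sum a m = sum a {1..m}"

lemma prefix_sum_0 [simp]: "prefix_sum a 0 = 0"
  by (simp add: prefix_sum_def)

lemma prefix_sum_Suc: "prefix_sum a (Suc m) = prefix_sum a m + a (Suc m)"
  by (simp add: prefix_sum_def)

lemma prefix_sum_cong: "(\<And>i. i \<in> {1..m} \<Longrightarrow> a i = b i) \<Longrightarrow> prefix_sum a m = prefix_sum b m"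
  by (simp add: prefix_sum_def)

definition suffix_sum :: "(nat \<Rightarrow> nat) \<Rightarrow> nat \<Rightarrow> nat \<Rightarrow> nat" where
  "suffix_sum a m i = sum a {i..m}"

lemma suffix_sum_Suc: "i \<le> m \<Longrightarrow> suffix_sum a m i = a i + suffix_sum a m (Suc i)"
  by (simp add: suffix_sum_def sum.atLeast_Suc_atMost)

lemma suffix_sum_end [simp]: "suffix_sum a m (Suc m) = 0"
  by (simp add: suffix_sum_def)

definition shift :: "(nat \<Rightarrow> nat) \<Rightarrow> nat \<Rightarrow> nat" where
  "shift a i = a (Suc i)"

lemma suffix_sum_shift: "suffix_sum (shift a) m i = suffix_sum a (Suc m) (Suc i)"
  unfolding suffix_sum_def shift_def by (simp add: sum.shift_bounds_cl_Suc_ivl del: sum.cl_ivl_Suc)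

lemma apply_in_order_Nil [simp]: "apply_in_order [] = Id"
  and apply_in_order_Cons [simp]: "apply_in_order (r # rs) = r O apply_in_order rs"
  by (simp_all add: apply_in_order_def)

lemma apply_in_order_append [simp]: "apply_in_order (rs @ qs) = apply_in_order rs O apply_in_order qs"
  by (induction rs) (auto simp: O_assoc)

lemma w_op_0 [simp]: "w_op K 0 j = Id"
  by (simp add: w_op_def)

lemma w_op_Suc: "w_op K (Suc k) j = arcs K (j + k) O w_op K k j"
  by (simp add: w_op_def)

lemma S_op_self: "1 \<le> m \<Longrightarrow> S_op K m m = w_op K m 1"
  by (simp add: S_op_def numeral_2_eq_2)

lemma S_op_Suc:
  assumes "k \<le> m"
  shows "S_op K (Suc m) k = S_op K m k O w_op K k (m + 2 - k)"
proof -
  have "[1..<Suc m - k + 2] = [1..<m - k + 2] @ [m + 2 - k]"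
    using assms by (simp add: Suc_diff_le)
  then show ?thesis unfolding S_op_def using assms by (simp add: Suc_diff_le del: upt_Suc)
qed

lemma single_valued_apply_in_order:
  "(\<And>r. r \<in> set rs \<Longrightarrow> single_valued r) \<Longrightarrow> single_valued (apply_in_order rs)"
  by (induction rs) (auto intro: single_valued_relcomp)

lemma component_refl: "v \<in> component K I v"
  by (simp add: component_def)

lemma component_sym: "w \<in> component K I v \<Longrightarrow> v \<in> component K I w"
proof -
  have "sym (\<Union>i\<in>I. arcs K i \<union> (arcs K i)\<inverse>)" by (auto simp: sym_def)
  then have "sym ((\<Union>i\<in>I. arcs K i \<union> (arcs K i)\<inverse>)\<^sup>*)" by (rule sym_rtrancl)
  then show "w \<in> component K I v \<Longrightarrow> v \<in> component K I w" by (simp add: component_def sym_def)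
qed

lemma component_trans: "v \<in> component K I u \<Longrightarrow> w \<in> component K I v \<Longrightarrow> w \<in> component K I u"
  unfolding component_def mem_Collect_eq by (rule rtrancl_trans)

lemma component_mono: "I \<subseteq> J \<Longrightarrow> v \<in> component K I u \<Longrightarrow> v \<in> component K J u"
  unfolding component_def mem_Collect_eq by (erule rev_subsetD) (intro rtrancl_mono UN_mono order_refl)

lemma component_arc: "(u, v) \<in> arcs K i \<Longrightarrow> i \<in> I \<Longrightarrow> v \<in> component K I u"
  unfolding component_def by (auto intro!: r_into_rtrancl)

lemma above_component: "(s, v) \<in> (\<Union>i\<in>I. arcs K i)\<^sup>* \<Longrightarrow> v \<in> component K I s"
  unfolding component_def mem_Collect_eq by (erule rev_subsetD) (intro rtrancl_mono UN_mono order_refl Un_upper1)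

definition agree :: "'v set \<Rightarrow> ('v \<times> 'v) set \<Rightarrow> ('v \<times> 'v) set \<Rightarrow> bool" where
  "agree C R R' \<longleftrightarrow> (\<forall>x\<in>C. \<forall>y. ((x, y) \<in> R \<longleftrightarrow> (x, y) \<in> R') \<and> ((x, y) \<in> R' \<longrightarrow> y \<in> C))"

lemma agree_Id: "agree C Id Id"
  by (simp add: agree_def)

lemma agree_relcomp: "agree C R R' \<Longrightarrow> agree C Q Q' \<Longrightarrow> agree C (R O Q) (R' O Q')"
  unfolding agree_def by blast

lemma agree_relpow: "agree C R R' \<Longrightarrow> agree C (R ^^ t) (R' ^^ t)"
  by (induction t) (simp_all add: agree_Id agree_relcomp)

lemma agree_apply_in_order:
  "(\<And>x. x \<in> set xs \<Longrightarrow> agree C (g x) (g' x)) \<Longrightarrow>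
    agree C (apply_in_order (map g xs)) (apply_in_order (map g' xs))"
  by (induction xs) (simp_all add: agree_Id agree_relcomp)

lemma agree_S_op:
  assumes "\<And>i. i \<in> {1..m} \<Longrightarrow> agree C (arcs H i) (arcs K i)" "k \<in> {1..m}"
  shows "agree C (S_op H m k) (S_op K m k)"
  unfolding S_op_def w_op_def using assms(2)
  by (intro agree_apply_in_order assms(1)) auto

context A_crystal
begin

abbreviation eps :: "nat \<Rightarrow> 'v \<Rightarrow> nat" where "eps i \<equiv> tail_len K i"

abbreviation phi :: "nat \<Rightarrow> 'v \<Rightarrow> nat" where "phi i \<equiv> head_len K i"

subsection \<open>Strings\<close>

lemma string_list:
  obtains p where "v \<in> set p" "distinct p"
    "\<And>m y. m < length p \<Longrightarrow> (p ! m, y) \<in> arcs K i \<longleftrightarrow> Suc m < length p \<and> y = p ! Suc m"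
    "\<And>m x. m < length p \<Longrightarrow> (x, p ! m) \<in> arcs K i \<longleftrightarrow> 0 < m \<and> x = p ! (m - 1)"
proof (cases "i \<in> {1..n} \<and> v \<in> verts K")
  case False
  then have "(x, y) \<notin> arcs K i" if "x = v \<or> y = v" for x y
    using arcs_verts[of i] arc_colors[of i] that by auto
  then show ?thesis by (intro that[of "[v]"]) auto
next
  case True
  define C where "C = component K {i} v"
  have vC: "v \<in> C" by (simp add: C_def component_def)
  have closed: "x \<in> C \<longleftrightarrow> y \<in> C" if "(x, y) \<in> arcs K i" for x y
  proof -
    have "(x, y) \<in> arcs K i \<union> (arcs K i)\<inverse>" "(y, x) \<in> arcs K i \<union> (arcs K i)\<inverse>"
      using that by auto
    then show ?thesis unfolding C_def component_def
      by (auto intro: rtrancl_into_rtrancl)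
  qed
  obtain p where p: "distinct p" "set p = C" "arcs K i \<inter> C \<times> C = set (zip p (tl p))"
    using strings[of i v] True by (auto simp: is_dipath_def subcrystal_def C_def)
  have arc: "(x, y) \<in> arcs K i \<longleftrightarrow> (\<exists>m. Suc m < length p \<and> p ! m = x \<and> p ! Suc m = y)"
    if "x \<in> set p \<or> y \<in> set p" for x y
  proof -
    have "(x, y) \<in> arcs K i \<longleftrightarrow> (x, y) \<in> set (zip p (tl p))"
      using closed p(2,3) that by blast
    then show ?thesis by (auto simp: in_set_zip nth_tl less_diff_conv)
  qed
  show ?thesis
  proof (rule that[of p])
    fix m y assume m: "m < length p"
    have "(p ! m, y) \<in> arcs K i \<longleftrightarrow> (\<exists>k. Suc k < length p \<and> p ! k = p ! m \<and> p ! Suc k = y)"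
      using arc m by simp
    also have "\<dots> \<longleftrightarrow> (\<exists>k. Suc k < length p \<and> k = m \<and> p ! Suc k = y)"
      using p(1) m by (metis Suc_lessD nth_eq_iff_index_eq)
    finally show "(p ! m, y) \<in> arcs K i \<longleftrightarrow> Suc m < length p \<and> y = p ! Suc m" by auto
  next
    fix m x assume m: "m < length p"
    have "(x, p ! m) \<in> arcs K i \<longleftrightarrow> (\<exists>k. Suc k < length p \<and> p ! k = x \<and> p ! Suc k = p ! m)"
      using arc m by simp
    also have "\<dots> \<longleftrightarrow> (\<exists>k. Suc k < length p \<and> p ! k = x \<and> Suc k = m)"
      using p(1) m by (metis nth_eq_iff_index_eq)
    finally show "(x, p ! m) \<in> arcs K i \<longleftrightarrow> 0 < m \<and> x = p ! (m - 1)"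
      using m by (cases m) auto
  qed (use p vC in auto)
qed

lemma string_position:
  obtains p m where "m < length p" "p ! m = v"
    "\<And>m y. m < length p \<Longrightarrow> (p ! m, y) \<in> arcs K i \<longleftrightarrow> Suc m < length p \<and> y = p ! Suc m"
    "\<And>m x. m < length p \<Longrightarrow> (x, p ! m) \<in> arcs K i \<longleftrightarrow> 0 < m \<and> x = p ! (m - 1)"
    "\<And>m. m < length p \<Longrightarrow> eps i (p ! m) = m"
    "\<And>m. m < length p \<Longrightarrow> phi i (p ! m) = length p - 1 - m"
proof -
  obtain p where p: "v \<in> set p" "distinct p"
    "\<And>m y. m < length p \<Longrightarrow> (p ! m, y) \<in> arcs K i \<longleftrightarrow> Suc m < length p \<and> y = p ! Suc m"
    "\<And>m x. m < length p \<Longrightarrow> (x, p ! m) \<in> arcs K i \<longleftrightarrow> 0 < m \<and> x = p ! (m - 1)"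
    by (rule string_list[of v i]) (rule that; assumption)
  have out: "m < length p \<Longrightarrow> (p ! m, y) \<in> arcs K i ^^ k \<longleftrightarrow> m + k < length p \<and> y = p ! (m + k)" for m k y
    by (induction k arbitrary: y) (auto simp: p(3) relcomp_unfold)
  have inn: "m < length p \<Longrightarrow> (x, p ! m) \<in> arcs K i ^^ k \<longleftrightarrow> k \<le> m \<and> x = p ! (m - k)" for m k x
  proof (induction k arbitrary: m)
    case (Suc k)
    have "(x, p ! m) \<in> arcs K i ^^ Suc k \<longleftrightarrow> 0 < m \<and> (x, p ! (m - 1)) \<in> arcs K i ^^ k"
      using Suc.prems by (auto simp: p(4) relcomp_unfold)
    then show ?case using Suc by (cases m) auto
  qed auto
  have e: "eps i (p ! m) = m" if "m < length p" for m
    unfolding tail_len_def by (rule Greatest_equality) (use inn that in auto)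
  have f: "phi i (p ! m) = length p - 1 - m" if "m < length p" for m
    unfolding head_len_def by (rule Greatest_equality) (use out that in auto)
  obtain m where "m < length p" "p ! m = v" using p(1) by (auto simp: in_set_conv_nth)
  then show ?thesis by (rule that) (fact p e f)+
qed

lemma eps_pos_iff: "0 < eps i v \<longleftrightarrow> (\<exists>u. (u, v) \<in> arcs K i)"
  by (rule string_position[of v i]) auto

lemma phi_pos_iff: "0 < phi i v \<longleftrightarrow> (\<exists>u. (v, u) \<in> arcs K i)"
  by (rule string_position[of v i]) auto

lemma arc_inj: "(u, v) \<in> arcs K i \<Longrightarrow> (u', v) \<in> arcs K i \<Longrightarrow> u = u'"
  by (rule string_position[of v i]) auto

lemma arc_fun: "(u, v) \<in> arcs K i \<Longrightarrow> (u, v') \<in> arcs K i \<Longrightarrow> v = v'"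
  by (rule string_position[of u i]) auto

lemma arc_lengths:
  assumes "(u, v) \<in> arcs K i"
  shows "eps i v = Suc (eps i u)" "phi i u = Suc (phi i v)"
  using assms by (rule_tac string_position[of u i], auto)+

text \<open>The operators are made total by letting them fix the vertices at the ends of a string.\<close>

definition e :: "nat \<Rightarrow> 'v \<Rightarrow> 'v" where
  "e i v = (if eps i v = 0 then v else THE u. (u, v) \<in> arcs K i)"

definition f :: "nat \<Rightarrow> 'v \<Rightarrow> 'v" where
  "f i v = (if phi i v = 0 then v else THE w. (v, w) \<in> arcs K i)"

definition etop :: "nat \<Rightarrow> 'v \<Rightarrow> 'v" where
  "etop i v = (e i ^^ eps i v) v"

lemma arc_iff_e: "(u, v) \<in> arcs K i \<longleftrightarrow> 0 < eps i v \<and> u = e i v"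
proof -
  have "(THE u. (u, v) \<in> arcs K i) = u" if "(u, v) \<in> arcs K i" for u
    by (intro the_equality that) (rule arc_inj[OF _ that])
  then show ?thesis using eps_pos_iff[of i v] by (auto simp: e_def)
qed

lemma arc_iff_f: "(u, v) \<in> arcs K i \<longleftrightarrow> 0 < phi i u \<and> v = f i u"
proof -
  have "(THE w. (u, w) \<in> arcs K i) = w" if "(u, w) \<in> arcs K i" for w
    by (intro the_equality that) (rule arc_fun[OF _ that])
  then show ?thesis using phi_pos_iff[of i u] by (auto simp: f_def)
qed

lemma e_eq_self: "eps i v = 0 \<Longrightarrow> e i v = v" by (simp add: e_def)

lemma f_eq_self: "phi i v = 0 \<Longrightarrow> f i v = v" by (simp add: f_def)

lemma e_arc: "0 < eps i v \<Longrightarrow> (e i v, v) \<in> arcs K i" by (simp add: arc_iff_e)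

lemma f_arc: "0 < phi i v \<Longrightarrow> (v, f i v) \<in> arcs K i" by (simp add: arc_iff_f)

lemma eps_e: "eps i (e i v) = eps i v - 1"
  using arc_lengths(1)[OF e_arc, of i v] by (cases "eps i v = 0") (auto simp: e_eq_self)

lemma eps_f: "0 < phi i v \<Longrightarrow> eps i (f i v) = Suc (eps i v)"
  using arc_lengths(1)[OF f_arc] .

lemma phi_f: "phi i (f i v) = phi i v - 1"
  using arc_lengths(2)[OF f_arc, of i v] by (cases "phi i v = 0") (auto simp: f_eq_self)

lemma e_f: "0 < phi i v \<Longrightarrow> e i (f i v) = v"
  using f_arc[of i v] arc_iff_e by metis

lemma f_e: "0 < eps i v \<Longrightarrow> f i (e i v) = v"
  using e_arc[of i v] arc_iff_f by metis

lemma etop_eq_self: "eps i v = 0 \<Longrightarrow> etop i v = v" by (simp add: etop_def)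

lemma etop_e: "etop i (e i v) = etop i v"
proof (cases "eps i v")
  case 0
  then show ?thesis by (simp add: e_eq_self)
next
  case (Suc k)
  then show ?thesis by (simp add: etop_def eps_e funpow_Suc_right del: funpow.simps)
qed

lemma etop_f: "etop i (f i v) = etop i v"
  using etop_e[of i "f i v"] f_eq_self[of i v] e_f[of i v]
  by (cases "phi i v = 0") simp_all

lemma eps_etop: "eps i (etop i v) = 0"
proof (induction "eps i v" arbitrary: v)
  case 0
  then show ?case by (simp add: etop_def)
next
  case (Suc k)
  then show ?case using Suc(1)[of "e i v"] by (simp add: eps_e etop_e)
qed

lemma eps_etop_inj:
  assumes "eps i u = eps i v" "etop i u = etop i v"
  shows "u = v"
  using assms
proof (induction "eps i v" arbitrary: u v)
  case 0
  then show ?case by (simp add: etop_def)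
next
  case (Suc k)
  then have "e i u = e i v" using Suc(1)[of "e i v" "e i u"] by (simp add: eps_e etop_e)
  moreover have "0 < eps i u" "0 < eps i v" using Suc by auto
  ultimately show ?case using f_e[of i u] f_e[of i v] by metis
qed

lemma phi_fpow: "phi i ((f i ^^ t) v) = phi i v - t"
  by (induction t) (simp_all add: phi_f)

lemma eps_fpow: "t \<le> phi i v \<Longrightarrow> eps i ((f i ^^ t) v) = eps i v + t"
  by (induction t) (simp_all add: eps_f phi_fpow)

lemma etop_fpow: "etop i ((f i ^^ t) v) = etop i v"
  by (induction t) (auto simp: etop_f)

lemma arc_in: "(u, v) \<in> arcs K i \<Longrightarrow> i \<in> {1..n} \<and> u \<in> verts K \<and> v \<in> verts K"
  using arcs_verts[of i] arc_colors[of i] by blast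

lemma not_color: "i \<notin> {1..n} \<Longrightarrow> eps i v = 0" "i \<notin> {1..n} \<Longrightarrow> phi i v = 0"
  using eps_pos_iff[of i v] phi_pos_iff[of i v] arc_in by blast+

lemma arc_neighbor:
  assumes "(u, v) \<in> arcs K i" "neighbors i j" "j \<in> {1..n}"
  shows "(eps j u = Suc (eps j v) \<and> phi j v = phi j u) \<or>
    (eps j v = eps j u \<and> phi j v = Suc (phi j u))"
proof -
  have i: "i \<in> {1..n}" "i \<noteq> j" using assms arc_in by (auto simp: neighbors_def)
  note tail_antimono[OF i(1) assms(3) i(2) assms(1)] head_mono[OF i(1) assms(3) i(2) assms(1)]
    length_change[OF i(1) assms(3) i(2) assms(1)]
  then show ?thesis using assms(2) by auto
qed

lemma arc_far:
  assumes "(u, v) \<in> arcs K i" "\<not> neighbors i j" "i \<noteq> j"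
  shows "eps j v = eps j u" "phi j v = phi j u"
proof -
  have i: "i \<in> {1..n}" using assms arc_in by auto
  have "eps j v = eps j u \<and> phi j v = phi j u"
  proof (cases "j \<in> {1..n}")
    case True
    note tail_antimono[OF i True assms(3,1)] head_mono[OF i True assms(3,1)]
      length_change[OF i True assms(3,1)]
    then show ?thesis using assms(2) by auto
  next
    case False
    then show ?thesis by (simp add: not_color)
  qed
  then show "eps j v = eps j u" "phi j v = phi j u" by auto
qed

lemma arc_eps_le:
  assumes "(u, v) \<in> arcs K i" "i \<noteq> j"
  shows "eps j v \<le> eps j u"
proof (cases "j \<in> {1..n}")
  case True
  show ?thesis using tail_antimono[OF _ True assms(2,1)] arc_in[OF assms(1)] by blast
qed (simp add: not_color)

definition wt :: "nat \<Rightarrow> 'v \<Rightarrow> int" where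
  "wt j v = int (phi j v) - int (eps j v)"

lemma arc_wt:
  assumes "(u, v) \<in> arcs K i" "j \<in> {1..n}"
  shows "wt j v = wt j u + (if i = j then - 2 else if neighbors i j then 1 else 0)"
proof -
  consider "i = j" | "neighbors i j" "i \<noteq> j" | "\<not> neighbors i j" "i \<noteq> j"
    by (auto simp: neighbors_def)
  then show ?thesis
  proof cases
    case 1
    then show ?thesis using arc_lengths[OF assms(1)] by (simp add: wt_def)
  next
    case 2
    then show ?thesis using arc_neighbor[OF assms(1) 2(1) assms(2)] by (auto simp: wt_def)
  next
    case 3
    then show ?thesis using arc_far[OF assms(1) 3] by (simp add: wt_def)
  qed
qed

text \<open>
  The weight \<open>wt\<close> changes along an \<open>i\<close>-arc by minus the \<open>i\<close>-th row of the Cartan matrix; paired with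
  the vector \<open>j (n + 1 - j)\<close> (twice the sum of the fundamental coweights), it drops by \<open>2\<close> along every arc.
\<close>

lemma wf_arcs: "wf (\<Union>i. arcs K i)"
proof -
  define H where "H v = (\<Sum>j=1..n. int j * int (n + 1 - j) * wt j v)" for v
  have step: "H v = H u - 2" if uv: "(u, v) \<in> arcs K i" for u v i
  proof -
    have i: "i \<in> {1..n}" using arc_in[OF uv] by simp
    define g where "g j = int j * (int n + 1 - int j) *
      (if i = j then - 2 else if neighbors i j then 1 else 0)" for j
    have "H v - H u = (\<Sum>j=1..n. int j * int (n + 1 - j) * (wt j v - wt j u))"
      by (simp add: H_def sum_subtractf right_diff_distrib)
    also have "\<dots> = (\<Sum>j=1..n. g j)"
      by (intro sum.cong) (auto simp: arc_wt[OF uv] g_def of_nat_diff)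
    also have "\<dots> = (\<Sum>j\<in>{0..n+1}. g j)"
    proof (intro sum.mono_neutral_left ballI)
      fix j assume "j \<in> {0..n+1} - {1..n}"
      then have "j = 0 \<or> j = n + 1" by auto
      then show "g j = 0" by (auto simp: g_def)
    qed auto
    also have "\<dots> = (\<Sum>j\<in>{i-1,i,i+1}. g j)"
      by (intro sum.mono_neutral_right) (use i in \<open>auto simp: g_def neighbors_def\<close>)
    also have "\<dots> = g (i - 1) + g i + g (i + 1)"
      using i by (auto simp: insert_commute)
    also have "\<dots> = - 2"
      using i by (auto simp: g_def neighbors_def of_nat_diff algebra_simps)
    finally show ?thesis by simp
  qed
  have "(\<Union>i. arcs K i) \<subseteq> measure (\<lambda>v. nat (Max (H ` verts K) - H v))"
  proof safe
    fix u v i assume uv: "(u, v) \<in> arcs K i"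
    have "H v \<le> Max (H ` verts K)" "H u \<le> Max (H ` verts K)"
      using arc_in[OF uv] finite_verts by auto
    then show "(u, v) \<in> measure (\<lambda>v. nat (Max (H ` verts K) - H v))"
      using step[OF uv] by auto
  qed
  then show ?thesis by (rule wf_subset[OF wf_measure])
qed

lemma arc_label:
  assumes "(u, v) \<in> arcs K i" "neighbors i j" "j \<in> {1..n}"
  shows "(label K j u v = 0 \<and> eps j u = Suc (eps j v)) \<or> (label K j u v = 1 \<and> eps j u = eps j v)"
  using arc_neighbor[OF assms] by (auto simp: label_def)

subsection \<open>Rank two\<close>

text \<open>
  The lengths of the alternating climbs \<open>i, j, i\<close> and \<open>j, i, j\<close> from a vertex to the source of its
  \<open>{i, j}\<close>-component: the string parametrizations for the two reduced words of type \<open>A\<^sub>2\<close>.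
\<close>

definition A2 :: "nat \<Rightarrow> nat \<Rightarrow> 'v \<Rightarrow> bool" where
  "A2 i j u \<longleftrightarrow>
    tropical (eps i u) (eps j (etop i u)) (eps i (etop j (etop i u)))
      (eps j u) (eps i (etop j u)) (eps j (etop i (etop j u))) \<and>
    etop j (etop i (etop j u)) = etop i (etop j (etop i u))"

lemma A2_sym: "A2 i j u \<Longrightarrow> A2 j i u"
  unfolding A2_def by (auto dest: tropical_sym)

lemma A2_step_no_j:
  assumes ij: "i \<in> {1..n}" "j \<in> {1..n}" "neighbors i j"
    and IH: "A2 i j (e i u)" and pos: "0 < eps i u" and zero: "eps j u = 0"
  shows "A2 i j u"
proof -
  define u' where "u' = e i u"
  obtain a where a: "eps i u = Suc a" using pos by (cases "eps i u") auto
  have arc: "(u', u) \<in> arcs K i" using pos by (simp add: u'_def e_arc)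
  have a': "eps i u' = a" by (simp add: u'_def eps_e a)
  have top: "etop i u' = etop i u" by (simp add: u'_def etop_e)
  have trop: "tropical a (eps j (etop i u)) (eps i (etop j (etop i u)))
      (eps j u') (eps i (etop j u')) (eps j (etop i (etop j u')))"
    using IH by (simp add: A2_def u'_def[symmetric] a' top)
  have lab: "label K j u' u = 0 \<and> eps j u' = 1 \<or> eps j u' = 0"
    using arc_label[OF arc ij(3,2)] zero by auto
  have "eps i (etop j (etop i u)) = 0"
  proof (rule ccontr)
    assume nz: "eps i (etop j (etop i u)) \<noteq> 0"
    then have p1: "eps j u' = 1" "label K j u' u = 0" "eps i (etop j (etop i u)) = 1"
      using trop lab unfolding tropical_def by auto
    define x where "x = e j u'"
    have xu': "(x, u') \<in> arcs K j" using p1 by (simp add: x_def e_arc)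
    have "etop j u' = x" using p1 by (simp add: etop_def x_def)
    then have "eps i x = Suc a" using trop p1 unfolding tropical_def by auto
    then have "label K i x u' = 0" "phi i u' = phi i x"
      using arc_label[OF xu' _ ij(1)] arc_neighbor[OF xu' _ ij(1)] ij(3) a' neighbors_sym by auto
    moreover have "0 < phi i u'" using arc phi_pos_iff by blast
    ultimately obtain y where y: "(x, y) \<in> arcs K i" using phi_pos_iff by metis
    obtain w where "(u', w) \<in> arcs K i" "(y, w) \<in> arcs K j"
      using square_out[OF ij(2,1) _ xu' y \<open>label K i x u' = 0\<close>] ij(3) neighbors_sym by blast
    then show False using arc_fun[OF arc] eps_pos_iff[of j u] zero by auto
  qed
  moreover from this have "eps j (etop i u) \<le> Suc a"
    using trop lab unfolding tropical_def by auto
  ultimately show ?thesis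
    using zero by (simp add: A2_def tropical_def etop_eq_self a)
qed

lemma A2_step_both:
  assumes ij: "i \<in> {1..n}" "j \<in> {1..n}" "neighbors i j"
    and IH: "\<And>x. (x, u) \<in> (\<Union>i. arcs K i)\<^sup>+ \<Longrightarrow> A2 i j x"
    and pos: "0 < eps i u" "0 < eps j u"
  shows "A2 i j u"
proof -
  define u' where "u' = e i u"
  define u'' where "u'' = e j u"
  have ji: "neighbors j i" using ij(3) neighbors_sym by simp
  have arc': "(u', u) \<in> arcs K i" using pos by (simp add: u'_def e_arc)
  have arc'': "(u'', u) \<in> arcs K j" using pos by (simp add: u''_def e_arc)
  have A': "A2 i j u'" using arc' by (intro IH r_into_trancl) auto
  have A'': "A2 i j u''" using arc'' by (intro IH r_into_trancl) auto
  obtain a where a: "eps i u = Suc a" using pos by (cases "eps i u") auto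
  obtain p where p: "eps j u = Suc p" using pos by (cases "eps j u") auto
  have a': "eps i u' = a" by (simp add: u'_def eps_e a)
  have p'': "eps j u'' = p" by (simp add: u''_def eps_e p)
  have top': "etop i u' = etop i u" by (simp add: u'_def etop_e)
  have top'': "etop j u'' = etop j u" by (simp add: u''_def etop_e)
  have climb: "eps k y = Suc (eps k x)" "etop k y = etop k x" if "(x, y) \<in> arcs K k" for x y k
    using that arc_lengths arc_iff_e etop_e by metis+
  have above: "A2 i j x" if "(x, y) \<in> arcs K k" "(y, u) \<in> (\<Union>i. arcs K i)\<^sup>+" for x y k
    using that by (intro IH trancl_into_trancl2[of x y]) auto
  have square: ?thesis if w: "(w, u') \<in> arcs K j" "(w, u'') \<in> arcs K i"
    and lab: "label K j u' u = 1 \<and> label K i u'' u = 0 \<or> label K j u' u = 0 \<and> label K i u'' u = 1" for w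
  proof -
    have Aw: "A2 i j w" using w(1) arc' by (intro above[OF w(1)] r_into_trancl) auto
    have tops: "etop j w = etop j u'" "etop i w = etop i u''"
      "eps j u' = Suc (eps j w)" "eps i u'' = Suc (eps i w)"
      using climb[OF w(1)] climb[OF w(2)] by auto
    have "tropical (Suc a) (eps j (etop i u)) (eps i (etop j (etop i u)))
        (Suc p) (eps i (etop j u)) (eps j (etop i (etop j u)))"
      using A' A'' Aw lab arc_label[OF arc' ij(3,2)] arc_label[OF arc'' ji ij(1)]
      by (intro tropical_square) (auto simp: A2_def a a' p p'' top' top'' tops)
    then show ?thesis using A' A'' Aw by (simp add: A2_def a p top' top'' tops)
  qed
  consider "label K j u' u = 1" | "label K i u'' u = 1" | "label K j u' u = 0" "label K i u'' u = 0"
    using arc_label[OF arc' ij(3,2)] arc_label[OF arc'' ji ij(1)] by blast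
  then show ?thesis
  proof cases
    case 1
    then show ?thesis using square_in[OF ij arc' arc''] square by blast
  next
    case 2
    then show ?thesis using square_in[OF ij(2,1) ji arc'' arc'] square by blast
  next
    case 3
    then obtain w where "(w, u) \<in> arcs K i O arcs K j O arcs K j O arcs K i"
      "(w, u) \<in> arcs K j O arcs K i O arcs K i O arcs K j"
      using octagon_in[OF ij arc' arc''] by blast
    then obtain z z' y y' where z: "(w, z) \<in> arcs K i" "(z, z') \<in> arcs K j" "(z', u') \<in> arcs K j"
      and y: "(w, y) \<in> arcs K j" "(y, y') \<in> arcs K i" "(y', u'') \<in> arcs K i"
      using arc_inj[OF arc'] arc_inj[OF arc''] by blast
    have up: "(u', u) \<in> (\<Union>i. arcs K i)\<^sup>+" "(u'', u) \<in> (\<Union>i. arcs K i)\<^sup>+"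
      using arc' arc'' by auto
    then have up': "(z', u) \<in> (\<Union>i. arcs K i)\<^sup>+" "(y', u) \<in> (\<Union>i. arcs K i)\<^sup>+"
      using z(3) y(3) by (meson UN_I UNIV_I trancl_into_trancl2)+
    then have up'': "(z, u) \<in> (\<Union>i. arcs K i)\<^sup>+" 
      using z(2) by (meson UN_I UNIV_I trancl_into_trancl2)
    have As: "A2 i j z" "A2 i j y" "A2 i j w"
      using above[OF z(2) up'(1)] above[OF y(2) up'(2)] above[OF z(1) up''] by auto
    note tops = climb[OF z(1)] climb[OF z(2)] climb[OF z(3)] climb[OF y(1)] climb[OF y(2)] climb[OF y(3)]
    have "tropical (Suc a) (eps j (etop i u)) (eps i (etop j (etop i u)))
        (Suc p) (eps i (etop j u)) (eps j (etop i (etop j u)))"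
      using A' A'' As 3 arc_label[OF arc' ij(3,2)] arc_label[OF arc'' ji ij(1)]
      by (intro tropical_octagon) (auto simp: A2_def a a' p p'' top'[symmetric] top''[symmetric] tops)
    then show ?thesis using A' A'' As by (simp add: A2_def a p top'[symmetric] top''[symmetric] tops)
  qed
qed

lemma A2_rule:
  assumes ij: "i \<in> {1..n}" "j \<in> {1..n}" "neighbors i j"
  shows "A2 i j u"
proof (induction u rule: wf_induct_rule[OF wf_trancl[OF wf_arcs]])
  case (1 u)
  have ji: "neighbors j i" using ij(3) neighbors_sym by simp
  have up: "(e k u, u) \<in> (\<Union>i. arcs K i)\<^sup>+" if "0 < eps k u" for k
    using e_arc[OF that] by auto
  show ?case
  proof (cases "eps i u = 0")
    case True
    show ?thesis
    proof (cases "eps j u = 0")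
      case True
      with \<open>eps i u = 0\<close> show ?thesis by (simp add: A2_def tropical_def etop_eq_self)
    next
      case False
      then show ?thesis
        using A2_step_no_j[OF ij(2,1) ji A2_sym[OF 1[OF up[of j]]]] True by (auto intro: A2_sym)
    qed
  next
    case False
    then show ?thesis
      using A2_step_no_j[OF ij 1[OF up[of i]]] A2_step_both[OF ij 1] by (cases "eps j u = 0") auto
  qed
qed

lemma color: "0 < eps i v \<or> 0 < phi i v \<Longrightarrow> i \<in> {1..n}"
  using not_color[of i v] by (metis less_irrefl)

subsection \<open>Far colors\<close>

definition far :: "nat \<Rightarrow> nat \<Rightarrow> bool" where
  "far i j \<longleftrightarrow> i \<noteq> j \<and> \<not> neighbors i j"

lemma far_sym: "far i j \<Longrightarrow> far j i"
  by (auto simp: far_def neighbors_sym)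

lemma far_e: "far i j \<Longrightarrow> eps j (e i v) = eps j v"
  using arc_far(1)[OF e_arc, of i v j, symmetric] e_eq_self[of i v]
  by (cases "eps i v = 0") (simp_all add: far_def)

lemma far_f:
  assumes "far i j"
  shows "eps j (f i v) = eps j v" "phi j (f i v) = phi j v"
  using arc_far[OF f_arc, of i v j] f_eq_self[of i v] assms
  by (cases "phi i v = 0"; auto simp: far_def)+

lemma e_far_commute:
  assumes "far i j"
  shows "e i (e j v) = e j (e i v)"
proof (cases "0 < eps i v \<and> 0 < eps j v")
  case True
  have ij: "i \<in> {1..n}" "j \<in> {1..n}" "i \<noteq> j" "\<not> neighbors i j"
    using True color[of i v] color[of j v] assms by (simp_all add: far_def)
  have "(e j (e i v), e i v) \<in> arcs K j" "(e i v, v) \<in> arcs K i"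
    using True far_e[OF assms] by (auto intro: e_arc)
  then have "(e j (e i v), v) \<in> arcs K i O arcs K j"
    using commute[OF ij] by blast
  then obtain x where "(e j (e i v), x) \<in> arcs K i" "(x, v) \<in> arcs K j" by blast
  then show ?thesis unfolding arc_iff_e by simp
next
  case False
  then show ?thesis using far_e[OF assms] far_e[OF far_sym[OF assms]] e_eq_self by auto
qed

lemma f_far_commute:
  assumes "far i j"
  shows "f i (f j v) = f j (f i v)"
proof (cases "0 < phi i v \<and> 0 < phi j v")
  case True
  have ij: "i \<in> {1..n}" "j \<in> {1..n}" "i \<noteq> j" "\<not> neighbors i j"
    using True color[of i v] color[of j v] assms by (simp_all add: far_def)
  have "(f i v, f j (f i v)) \<in> arcs K j" "(v, f i v) \<in> arcs K i"
    using True far_f[OF assms] by (auto intro: f_arc)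
  then have "(v, f j (f i v)) \<in> arcs K j O arcs K i"
    using commute[OF ij] by blast
  then obtain x where "(v, x) \<in> arcs K j" "(x, f j (f i v)) \<in> arcs K i" by blast
  then show ?thesis unfolding arc_iff_f by simp
next
  case False
  then show ?thesis using far_f[OF assms] far_f[OF far_sym[OF assms]] f_eq_self by auto
qed

lemma far_epow: "far i j \<Longrightarrow> eps j ((e i ^^ t) v) = eps j v"
  by (induction t) (simp_all add: far_e)

lemma far_fpow:
  assumes "far i j"
  shows "eps j ((f i ^^ t) v) = eps j v" "phi j ((f i ^^ t) v) = phi j v"
  by (induction t) (simp_all add: far_f[OF assms])

lemma far_etop: "far i j \<Longrightarrow> eps j (etop i v) = eps j v"
  by (simp add: etop_def far_epow)

lemma etop_far_commute:
  assumes "far i j"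
  shows "etop i (etop j v) = etop j (etop i v)"
proof -
  have "e i ((e j ^^ t) x) = (e j ^^ t) (e i x)" for t x
    by (rule funpow_commute_of_commute[where g = "e i" and h = "e j"]) (rule e_far_commute[OF assms])
  then have "(e j ^^ t) ((e i ^^ r) x) = (e i ^^ r) ((e j ^^ t) x)" for t r x
    by (intro funpow_commute_of_commute[where g = "e j ^^ _" and h = "e i"]) simp
  then show ?thesis
    using far_epow[OF assms] far_epow[OF far_sym[OF assms]] by (simp add: etop_def)
qed

lemma fpow_far_commute:
  "far i j \<Longrightarrow> f i ((f j ^^ t) x) = (f j ^^ t) (f i x)"
  by (rule funpow_commute_of_commute[where g = "f i" and h = "f j"]) (rule f_far_commute)

lemma arc_fpow_far:
  assumes "far i j" "(u, v) \<in> arcs K i"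
  shows "((f j ^^ t) u, (f j ^^ t) v) \<in> arcs K i"
  using assms far_fpow[OF far_sym[OF assms(1)]] fpow_far_commute[OF assms(1)] by (simp add: arc_iff_f)

subsection \<open>Sources of subcrystals\<close>

definition is_source :: "nat set \<Rightarrow> 'v \<Rightarrow> bool" where
  "is_source I s \<longleftrightarrow> (\<forall>i\<in>I. eps i s = 0)"

lemma etop_above: "(etop i v, v) \<in> (arcs K i)\<^sup>*"
proof (induction "eps i v" arbitrary: v)
  case (Suc k)
  then have "(etop i (e i v), e i v) \<in> (arcs K i)\<^sup>*" by (simp add: eps_e)
  moreover have "(e i v, v) \<in> arcs K i" using Suc by (intro e_arc) simp
  ultimately show ?case by (simp add: etop_e rtrancl_into_rtrancl)
qed (simp add: etop_eq_self)

lemma etop_above_in: "i \<in> I \<Longrightarrow> (etop i v, v) \<in> (\<Union>i\<in>I. arcs K i)\<^sup>*"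
  using etop_above[of i v] by (meson UN_upper rtrancl_mono subsetD)

lemma source_above_exists: "\<exists>s. (s, v) \<in> (\<Union>i\<in>I. arcs K i)\<^sup>* \<and> is_source I s"
proof (induction v rule: wf_induct_rule[OF wf_arcs])
  case (1 v)
  show ?case
  proof (cases "is_source I v")
    case False
    then obtain i where i: "i \<in> I" "0 < eps i v" by (auto simp: is_source_def)
    then obtain s where "(s, e i v) \<in> (\<Union>i\<in>I. arcs K i)\<^sup>*" "is_source I s"
      using 1[of "e i v"] e_arc by blast
    moreover have "(e i v, v) \<in> (\<Union>i\<in>I. arcs K i)" using i e_arc by blast
    ultimately show ?thesis by (meson rtrancl_into_rtrancl)
  qed auto
qed

lemma common_ancestor:
  assumes "i \<in> I" "j \<in> I" "i \<noteq> j" "0 < eps i v" "0 < eps j v"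
  shows "\<exists>t. (t, e i v) \<in> (\<Union>i\<in>I. arcs K i)\<^sup>* \<and> (t, e j v) \<in> (\<Union>i\<in>I. arcs K i)\<^sup>*"
proof (cases "neighbors i j")
  case True
  have "i \<in> {1..n}" "j \<in> {1..n}" using assms color[of i v] color[of j v] by simp_all
  then have "etop j (etop i (etop j v)) = etop i (etop j (etop i v))"
    using A2_rule[OF _ _ True] by (simp add: A2_def)
  moreover have "(etop k (etop l (etop k v)), e k v) \<in> (\<Union>i\<in>I. arcs K i)\<^sup>*"
    if "k \<in> I" "l \<in> I" for k l
    using etop_above_in[OF that(1), of "e k v"] etop_above_in[OF that(2), of "etop k v"]
      etop_above_in[OF that(1), of "etop l (etop k v)"] by (simp add: etop_e)
  ultimately show ?thesis using assms(1,2) by (intro exI[of _ "etop i (etop j (etop i v))"]) metis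
next
  case False
  then have far: "far i j" using assms by (simp add: far_def)
  have "(e j (e i v), e i v) \<in> arcs K j" "(e i (e j v), e j v) \<in> arcs K i"
    using assms far_e[OF far] far_e[OF far_sym[OF far]] by (auto intro: e_arc)
  then show ?thesis using e_far_commute[OF far, of v] assms(1,2) 
    by (intro exI[of _ "e i (e j v)"]) (auto intro!: r_into_rtrancl)
qed

lemma source_above_unique:
  assumes "(s, v) \<in> (\<Union>i\<in>I. arcs K i)\<^sup>*" "is_source I s"
    and "(s', v) \<in> (\<Union>i\<in>I. arcs K i)\<^sup>*" "is_source I s'"
  shows "s = s'"
  using assms
proof (induction v arbitrary: s s' rule: wf_induct_rule[OF wf_arcs])
  case (1 v)
  have last: "s = v \<and> is_source I v \<or> (\<exists>i\<in>I. 0 < eps i v \<and> (s, e i v) \<in> (\<Union>i\<in>I. arcs K i)\<^sup>*)"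
    if "(s, v) \<in> (\<Union>i\<in>I. arcs K i)\<^sup>*" "is_source I s" for s
    using that by (cases rule: rtranclE) (auto simp: arc_iff_e)
  have IH: "s = s'" if "0 < eps i v" "(s, e i v) \<in> (\<Union>i\<in>I. arcs K i)\<^sup>*" "is_source I s"
      "(s', e i v) \<in> (\<Union>i\<in>I. arcs K i)\<^sup>*" "is_source I s'" for s s' i
    using that 1(1)[of "e i v"] e_arc[of i v] by blast
  show ?case
  proof (cases "is_source I v")
    case True
    then show ?thesis using last[OF 1(2,3)] last[OF 1(4,5)] by (auto simp: is_source_def)
  next
    case False
    obtain i where i: "i \<in> I" "0 < eps i v" "(s, e i v) \<in> (\<Union>i\<in>I. arcs K i)\<^sup>*"
      using last[OF 1(2,3)] False by blast
    obtain j where j: "j \<in> I" "0 < eps j v" "(s', e j v) \<in> (\<Union>i\<in>I. arcs K i)\<^sup>*"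
      using last[OF 1(4,5)] False by blast
    show ?thesis
    proof (cases "i = j")
      case True
      then show ?thesis using IH[OF i(2,3) 1(3)] j 1(5) by simp
    next
      case False
      then obtain t where t: "(t, e i v) \<in> (\<Union>i\<in>I. arcs K i)\<^sup>*" "(t, e j v) \<in> (\<Union>i\<in>I. arcs K i)\<^sup>*"
        using common_ancestor i j by blast
      obtain r where r: "(r, t) \<in> (\<Union>i\<in>I. arcs K i)\<^sup>*" "is_source I r"
        using source_above_exists by blast
      have "s = r" using IH[OF i(2,3) 1(3) _ r(2)] rtrancl_trans[OF r(1) t(1)] by simp
      moreover have "s' = r" using IH[OF j(2,3) 1(5) _ r(2)] rtrancl_trans[OF r(1) t(2)] by simp
      ultimately show ?thesis by simp
    qed
  qed
qed

lemma component_source_unique: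
  assumes "y \<in> component K I x" "is_source I x" "is_source I y"
  shows "x = y"
proof -
  let ?A = "\<lambda>s v. (s, v) \<in> (\<Union>i\<in>I. arcs K i)\<^sup>* \<and> is_source I s"
  have step: "?A s u \<longleftrightarrow> ?A s v" if uv: "(u, v) \<in> (\<Union>i\<in>I. arcs K i)" for u v s
  proof -
    have down: "?A s v" if "?A s u" for s using that uv by (meson rtrancl_into_rtrancl)
    then show ?thesis using source_above_exists[of u I] source_above_unique by metis
  qed
  have "(x, y) \<in> (\<Union>i\<in>I. arcs K i \<union> (arcs K i)\<inverse>)\<^sup>*" using assms(1) by (simp add: component_def)
  then have "?A x y"
  proof (induction rule: rtrancl_induct)
    case (step y z)
    then have "(y, z) \<in> (\<Union>i\<in>I. arcs K i) \<or> (z, y) \<in> (\<Union>i\<in>I. arcs K i)" by auto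
    then show ?case using step.IH \<open>\<And>u v s. _ \<Longrightarrow> ?A s u \<longleftrightarrow> ?A s v\<close> by blast
  qed (use assms in auto)
  then show ?thesis using source_above_unique[of x y I y] assms(3) by simp
qed

subsection \<open>Upper sources and principal vertices\<close>

text \<open>
  If \<open>s\<close> is a source for the colors \<open>1, \<dots>, m\<close>, then \<open>sigma m a s\<close> is the source of the upper
  subcrystal (colors \<open>1, \<dots>, m - 1\<close>) that contains the principal vertex with coordinate \<open>a\<close>.
\<close>

fun sigma :: "nat \<Rightarrow> (nat \<Rightarrow> nat) \<Rightarrow> 'v \<Rightarrow> 'v" where
  "sigma 0 a s = s"
| "sigma (Suc m) a s = (f (Suc m) ^^ prefix_sum a (Suc m)) (sigma m a s)"

definition admissible :: "nat \<Rightarrow> (nat \<Rightarrow> nat) \<Rightarrow> 'v \<Rightarrow> bool" where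
  "admissible m a s \<longleftrightarrow> m \<le> n \<and> is_source {1..m} s \<and> (\<forall>i\<in>{1..m}. a i \<le> phi i s)"

lemma sigma_cong: "(\<And>i. i \<in> {1..m} \<Longrightarrow> a i = b i) \<Longrightarrow> sigma m a s = sigma m b s"
proof (induction m)
  case (Suc m)
  then have "prefix_sum a (Suc m) = prefix_sum b (Suc m)" by (intro prefix_sum_cong) auto
  then show ?case using Suc by simp
qed simp

lemma fpow_eps_zero: "eps j v = 0 \<Longrightarrow> i \<noteq> j \<Longrightarrow> eps j ((f i ^^ t) v) = 0"
proof (induction t)
  case (Suc t)
  then show ?case
    using arc_eps_le[OF f_arc, of i "(f i ^^ t) v" j] f_eq_self[of i "(f i ^^ t) v"]
    by (cases "phi i ((f i ^^ t) v) = 0") auto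
qed simp

lemma fpow_wt:
  assumes "t \<le> phi i v" "j \<in> {1..n}"
  shows "wt j ((f i ^^ t) v) = wt j v + int t * (if i = j then - 2 else if neighbors i j then 1 else 0)"
  using assms(1)
proof (induction t)
  case (Suc t)
  then have "0 < phi i ((f i ^^ t) v)" by (simp add: phi_fpow)
  from arc_wt[OF f_arc[OF this] assms(2)] Suc show ?case by (simp add: algebra_simps)
qed simp

lemma sigma_higher:
  assumes "admissible m a s" "k \<le> m"
  shows "(\<forall>j. k < j \<longrightarrow> j \<le> m \<longrightarrow> eps j (sigma k a s) = 0) \<and>
    (\<forall>j\<in>{1..m}. wt j (sigma k a s) = wt j s - (if j \<le> k then 2 * int (prefix_sum a j) else 0)
      + (if j \<le> k + 1 then int (prefix_sum a (j - 1)) else 0)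
      + (if j < k then int (prefix_sum a (j + 1)) else 0)) \<and>
    (k < m \<longrightarrow> prefix_sum a (Suc k) \<le> phi (Suc k) (sigma k a s))"
  using assms(2)
proof (induction k)
  case 0
  then show ?case using assms(1) by (auto simp: admissible_def is_source_def prefix_sum_Suc)
next
  case (Suc k)
  have mn: "m \<le> n" using assms(1) by (simp add: admissible_def)
  have le: "prefix_sum a (Suc k) \<le> phi (Suc k) (sigma k a s)" using Suc by simp
  have eps: "\<forall>j. Suc k < j \<longrightarrow> j \<le> m \<longrightarrow> eps j (sigma (Suc k) a s) = 0"
    using Suc by (simp add: fpow_eps_zero)
  moreover have wts: "\<forall>j\<in>{1..m}. wt j (sigma (Suc k) a s) =
      wt j s - (if j \<le> Suc k then 2 * int (prefix_sum a j) else 0)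
      + (if j \<le> Suc k + 1 then int (prefix_sum a (j - 1)) else 0)
      + (if j < Suc k then int (prefix_sum a (j + 1)) else 0)"
  proof
    fix j assume j: "j \<in> {1..m}"
    have s1: "wt j (sigma (Suc k) a s) = wt j (sigma k a s) + int (prefix_sum a (Suc k)) *
        (if Suc k = j then - 2 else if neighbors (Suc k) j then 1 else 0)"
      using fpow_wt[OF le, of j] j mn by simp
    have s2: "wt j (sigma k a s) = wt j s - (if j \<le> k then 2 * int (prefix_sum a j) else 0)
      + (if j \<le> k + 1 then int (prefix_sum a (j - 1)) else 0)
      + (if j < k then int (prefix_sum a (j + 1)) else 0)" using Suc j by simp
    consider "j < k" | "j = k" | "j = Suc k" | "j = Suc (Suc k)" | "j > Suc (Suc k)" by linarith
    then show "wt j (sigma (Suc k) a s) =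
      wt j s - (if j \<le> Suc k then 2 * int (prefix_sum a j) else 0)
      + (if j \<le> Suc k + 1 then int (prefix_sum a (j - 1)) else 0)
      + (if j < Suc k then int (prefix_sum a (j + 1)) else 0)"
    proof cases
      case 1
      then have "\<not> neighbors (Suc k) j" "Suc k \<noteq> j" by (simp_all add: neighbors_def)
      then show ?thesis unfolding s1 s2 using 1 by simp
    next
      case 2
      then have "neighbors (Suc k) j" by (simp add: neighbors_def)
      then show ?thesis unfolding s1 s2 using 2 by simp
    next
      case 3
      then show ?thesis unfolding s1 s2 by simp
    next
      case 4
      then have "neighbors (Suc k) j" by (simp add: neighbors_def)
      then show ?thesis unfolding s1 s2 using 4 by simp
    next
      case 5
      then have "\<not> neighbors (Suc k) j" "Suc k \<noteq> j" by (simp_all add: neighbors_def)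
      then show ?thesis unfolding s1 s2 using 5 by simp
    qed
  qed
  moreover have "prefix_sum a (Suc (Suc k)) \<le> phi (Suc (Suc k)) (sigma (Suc k) a s)" if "Suc k < m"
  proof -
    have "wt (Suc (Suc k)) (sigma (Suc k) a s) = wt (Suc (Suc k)) s + int (prefix_sum a (Suc k))"
      using wts that by simp
    then have "phi (Suc (Suc k)) (sigma (Suc k) a s) = phi (Suc (Suc k)) s + prefix_sum a (Suc k)"
      using eps that assms(1) by (simp add: wt_def admissible_def is_source_def del: sigma.simps)
    then show ?thesis using assms(1) that by (simp add: admissible_def prefix_sum_Suc del: sigma.simps)
  qed
  ultimately show ?case by simp
qed

lemma sigma_string:
  assumes "admissible m a s" "Suc k \<le> m"
  shows "eps (Suc k) (sigma (Suc k) a s) = prefix_sum a (Suc k)" "etop (Suc k) (sigma (Suc k) a s) = sigma k a s"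
  using sigma_higher[OF assms(1), of k] assms(2)
  by (simp_all add: eps_fpow etop_fpow etop_eq_self)

lemma sigma_source:
  assumes "admissible m a s" "k \<le> m"
  shows "is_source {1..k - 1} (sigma k a s)"
  using assms(2)
proof (induction k)
  case 0
  then show ?case by (simp add: is_source_def)
next
  case (Suc k)
  have "eps i (sigma (Suc k) a s) = 0" if i: "i \<in> {1..k}" for i
  proof (cases "i = k")
    case False
    then show ?thesis using Suc i by (auto simp: is_source_def intro!: fpow_eps_zero)
  next
    case True
    then obtain l where k: "k = Suc l" using i by (cases k) auto
    have "A2 (Suc k) k (sigma (Suc k) a s)"
      using Suc.prems i assms(1) True by (intro A2_rule) (auto simp: admissible_def neighbors_def)
    moreover have "eps (Suc k) (sigma l a s) = 0" using sigma_higher[OF assms(1), of l] Suc.prems k by simp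
    moreover have "eps (Suc k) (sigma (Suc k) a s) = prefix_sum a (Suc k)" "etop (Suc k) (sigma (Suc k) a s) = sigma k a s"
      "eps k (sigma k a s) = prefix_sum a k" "etop k (sigma k a s) = sigma l a s"
      using sigma_string[OF assms(1), of k] sigma_string[OF assms(1), of l] Suc.prems k by (simp_all del: sigma.simps)
    ultimately have "tropical (prefix_sum a (Suc k)) (prefix_sum a k) 0 (eps k (sigma (Suc k) a s))
        (eps (Suc k) (etop k (sigma (Suc k) a s))) (eps k (etop (Suc k) (etop k (sigma (Suc k) a s))))"
      by (simp add: A2_def del: sigma.simps)
    then have "eps k (sigma (Suc k) a s) = 0" unfolding tropical_def prefix_sum_Suc by linarith
    then show ?thesis using True by (simp del: sigma.simps)
  qed
  then show ?case by (simp add: is_source_def del: sigma.simps)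
qed

lemma sigma_phi:
  assumes "admissible (Suc m) a s" "i \<in> {1..m}"
  shows "phi i (sigma (Suc m) a s) + a i = phi i s + a (Suc i)"
proof -
  have "wt i (sigma (Suc m) a s) = wt i s - 2 * int (prefix_sum a i) + int (prefix_sum a (i - 1)) + int (prefix_sum a (i + 1))"
    using sigma_higher[OF assms(1), of "Suc m"] assms(2) by (simp del: sigma.simps)
  moreover have "eps i s = 0" "eps i (sigma (Suc m) a s) = 0"
    using sigma_source[OF assms(1), of "Suc m"] assms by (auto simp: admissible_def is_source_def)
  moreover have "prefix_sum a i = prefix_sum a (i - 1) + a i" "prefix_sum a (i + 1) = prefix_sum a i + a (Suc i)"
    using assms(2) by (cases i; simp add: prefix_sum_Suc)+
  ultimately show ?thesis by (simp add: wt_def del: sigma.simps)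
qed

lemma sigma_admissible:
  assumes "admissible (Suc m) a s"
    and "\<And>i. i \<in> {1..m} \<Longrightarrow> b i + a i \<le> phi i s + a (Suc i)"
  shows "admissible m b (sigma (Suc m) a s)"
proof -
  have "b i \<le> phi i (sigma (Suc m) a s)" if "i \<in> {1..m}" for i
    using assms(2)[OF that] sigma_phi[OF assms(1) that] by simp
  then show ?thesis
    using sigma_source[OF assms(1), of "Suc m"] assms(1) by (auto simp: admissible_def simp del: sigma.simps)
qed

fun pvertex :: "nat \<Rightarrow> (nat \<Rightarrow> nat) \<Rightarrow> 'v \<Rightarrow> 'v" where
  "pvertex 0 a s = s"
| "pvertex (Suc m) a s = pvertex m (shift a) (sigma (Suc m) a s)"

lemma pvertex_cong: "(\<And>i. i \<in> {1..m} \<Longrightarrow> a i = b i) \<Longrightarrow> pvertex m a s = pvertex m b s"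
proof (induction m arbitrary: a b s)
  case (Suc m)
  have "sigma (Suc m) a s = sigma (Suc m) b s" using Suc.prems by (rule sigma_cong)
  moreover have "pvertex m (shift a) t = pvertex m (shift b) t" for t
    by (rule Suc.IH) (use Suc.prems in \<open>simp add: shift_def\<close>)
  ultimately show ?case by (simp del: sigma.simps)
qed simp

lemma far_higher: "1 \<le> i \<Longrightarrow> i \<le> m \<Longrightarrow> m + 2 \<le> j \<Longrightarrow> far j i"
  by (auto simp: far_def neighbors_def)

lemma sigma_far:
  assumes "m + 2 \<le> j"
  shows "eps j (sigma m a s) = eps j s" "sigma m a ((f j ^^ t) s) = (f j ^^ t) (sigma m a s)"
    "(s, s') \<in> arcs K j \<Longrightarrow> (sigma m a s, sigma m a s') \<in> arcs K j"
proof -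
  have *: "eps j (sigma m a s) = eps j s \<and> sigma m a ((f j ^^ t) s) = (f j ^^ t) (sigma m a s) \<and>
      ((s, s') \<in> arcs K j \<longrightarrow> (sigma m a s, sigma m a s') \<in> arcs K j)"
    using assms
  proof (induction m)
    case (Suc m)
    have far: "far (Suc m) j" "far j (Suc m)"
      using far_higher[of "Suc m" "Suc m" j] Suc.prems far_sym by auto
    have "(f (Suc m) ^^ r) ((f j ^^ t) x) = (f j ^^ t) ((f (Suc m) ^^ r) x)" for x r
      by (rule funpow_commute_of_commute[where g = "f (Suc m) ^^ r" and h = "f j"])
        (rule fpow_far_commute[OF far(2), symmetric])
    then show ?case using Suc far_fpow[OF far(1)] arc_fpow_far[OF far(2)] by simp
  qed simp
  then show "eps j (sigma m a s) = eps j s" "sigma m a ((f j ^^ t) s) = (f j ^^ t) (sigma m a s)"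
    "(s, s') \<in> arcs K j \<Longrightarrow> (sigma m a s, sigma m a s') \<in> arcs K j"
    by auto
qed

lemma pvertex_arc_far:
  "(s, s') \<in> arcs K j \<Longrightarrow> m + 2 \<le> j \<Longrightarrow> (pvertex m a s, pvertex m a s') \<in> arcs K j"
proof (induction m arbitrary: a s s')
  case (Suc m)
  show ?case unfolding pvertex.simps
    by (rule Suc.IH) (use Suc.prems in \<open>simp_all add: sigma_far(3) del: sigma.simps\<close>)
qed simp

lemma arc_from_string:
  assumes "eps i v = Suc (eps i u)" "etop i u = etop i v"
  shows "(u, v) \<in> arcs K i"
proof -
  have "e i v = u" by (rule eps_etop_inj[of i]) (simp_all add: assms eps_e etop_e)
  then show ?thesis using assms(1) by (simp add: arc_iff_e)
qed

lemma admissible_mono: "admissible m a s \<Longrightarrow> l \<le> m \<Longrightarrow> admissible l a s"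
  by (auto simp: admissible_def is_source_def)

lemma two_row_string:
  assumes a: "admissible (Suc (Suc l)) a s"
    and r: "admissible (Suc l) r (sigma (Suc (Suc l)) a s)"
  defines "x \<equiv> sigma (Suc l) r (sigma (Suc (Suc l)) a s)" and "w \<equiv> sigma l r (sigma (Suc l) a s)"
  shows "tropical (prefix_sum r (Suc l)) (prefix_sum a (Suc (Suc l))) (eps (Suc l) w)
      (eps (Suc (Suc l)) x) (eps (Suc l) (etop (Suc (Suc l)) x))
      (eps (Suc (Suc l)) (etop (Suc l) (etop (Suc (Suc l)) x)))"
    and "etop (Suc (Suc l)) (etop (Suc l) (etop (Suc (Suc l)) x)) = etop (Suc l) w"
proof -
  let ?y = "sigma (Suc (Suc l)) a s"
  have x: "eps (Suc l) x = prefix_sum r (Suc l)" "etop (Suc l) x = sigma l r ?y"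
    unfolding x_def by (rule sigma_string[OF r]; simp)+
  have y: "eps (Suc (Suc l)) ?y = prefix_sum a (Suc (Suc l))"
    by (rule sigma_string[OF a]) simp
  have far: "l + 2 \<le> Suc (Suc l)" by simp
  have 1: "eps (Suc (Suc l)) (sigma l r ?y) = prefix_sum a (Suc (Suc l))"
    using sigma_far(1)[OF far, of r ?y] y by simp
  have "eps (Suc (Suc l)) w = 0"
    unfolding w_def sigma_far(1)[OF far] using sigma_higher[OF a, of "Suc l"] by (simp del: sigma.simps)
  then have 2: "etop (Suc (Suc l)) (sigma l r ?y) = w"
    unfolding sigma.simps(2)[of "Suc l" a] sigma_far(2)[OF far] etop_fpow
    by (simp add: etop_eq_self w_def)
  have "A2 (Suc l) (Suc (Suc l)) x"
    using a by (intro A2_rule) (auto simp: admissible_def neighbors_def)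
  then show "tropical (prefix_sum r (Suc l)) (prefix_sum a (Suc (Suc l))) (eps (Suc l) w)
      (eps (Suc (Suc l)) x) (eps (Suc l) (etop (Suc (Suc l)) x))
      (eps (Suc (Suc l)) (etop (Suc l) (etop (Suc (Suc l)) x)))"
    "etop (Suc (Suc l)) (etop (Suc l) (etop (Suc (Suc l)) x)) = etop (Suc l) w"
    unfolding A2_def x 1 2 by simp_all
qed

text \<open>
  The case \<open>k = Suc m\<close> is included: then \<open>r\<close> and \<open>shift a\<close> agree on the indices \<open>1, \<dots>, m\<close> used by \<open>sigma m\<close>.
\<close>

lemma two_row_arc:
  assumes "admissible (Suc m) a s" "1 \<le> k" "\<And>i. k < i \<Longrightarrow> i \<le> Suc m \<Longrightarrow> a i = 0"
    "k \<le> Suc m \<Longrightarrow> a k < phi k s"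
  defines "r \<equiv> (shift a)(k := Suc (shift a k))" and "a' \<equiv> a(k := Suc (a k))"
  shows "eps (Suc m) (sigma m r (sigma (Suc m) a s)) = a 1 \<and>
    (k \<le> Suc m \<longrightarrow> (sigma m r (sigma (Suc m) a s), sigma m (shift a) (sigma (Suc m) a' s)) \<in> arcs K (Suc m))"
  using assms(1,3,4)
proof (induction m)
  case 0
  have "a 1 \<le> phi 1 s" "eps 1 s = 0" using 0 by (auto simp: admissible_def is_source_def)
  moreover have "((f (Suc 0) ^^ a 1) s, (f (Suc 0) ^^ Suc (a 1)) s) \<in> arcs K 1" if "k = 1"
    using 0 that f_arc[of "Suc 0" "(f (Suc 0) ^^ a 1) s"] by (simp add: phi_fpow)
  ultimately show ?case using assms(2) by (auto simp: prefix_sum_Suc eps_fpow a'_def)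
next
  case (Suc l)
  have ad: "admissible (Suc (Suc l)) a s" by fact
  have ar: "admissible (Suc l) r (sigma (Suc (Suc l)) a s)"
    using ad Suc.prems(3) by (intro sigma_admissible) (auto simp: r_def shift_def admissible_def Suc_le_eq)
  have IH: "eps (Suc l) (sigma l r (sigma (Suc l) a s)) = a 1"
    "k \<le> Suc l \<Longrightarrow> (sigma l r (sigma (Suc l) a s), sigma l (shift a) (sigma (Suc l) a' s)) \<in> arcs K (Suc l)"
    using Suc.IH[OF admissible_mono[OF ad]] Suc.prems by auto
  have R: "prefix_sum r j + a 1 = prefix_sum a (Suc j) + (if k \<le> j then 1 else 0)" for j
    using assms(2) by (induction j) (auto simp: prefix_sum_Suc r_def shift_def)
  have R': "prefix_sum (shift a) j + a 1 = prefix_sum a (Suc j)" for j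
    by (induction j) (auto simp: prefix_sum_Suc shift_def)
  have L': "prefix_sum a' j = prefix_sum a j + (if k \<le> j then 1 else 0)" for j
    using assms(2) by (induction j) (auto simp: prefix_sum_Suc a'_def)
  define x where "x = sigma (Suc l) r (sigma (Suc (Suc l)) a s)"
  note x = two_row_string[OF ad ar, folded x_def, unfolded IH(1)]
  have epsx: "eps (Suc (Suc l)) x = a 1"
  proof (cases "k \<le> Suc l")
    case True
    then show ?thesis using x(1) R[of "Suc l"] Suc.prems(2)[of "Suc (Suc l)"] unfolding tropical_def
      by (simp) linarith
  next
    case False
    then show ?thesis using x(1) R[of "Suc l"] unfolding tropical_def by simp linarith
  qed
  show ?case unfolding x_def[symmetric]
  proof (intro conjI impI)
    show "eps (Suc (Suc l)) x = a 1" by fact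
    assume k: "k \<le> Suc (Suc l)"
    have ad': "admissible (Suc (Suc l)) a' s"
      using ad Suc.prems(3) k by (auto simp: a'_def admissible_def)
    have ar': "admissible (Suc l) (shift a) (sigma (Suc (Suc l)) a' s)"
    proof (intro sigma_admissible[OF ad'])
      fix i assume "i \<in> {1..Suc l}"
      then have "a' i \<le> phi i s" "shift a i \<le> a' (Suc i)"
        using ad' by (auto simp: admissible_def a'_def shift_def)
      then show "shift a i + a' i \<le> phi i s + a' (Suc i)" by simp
    qed
    define x' where "x' = sigma (Suc l) (shift a) (sigma (Suc (Suc l)) a' s)"
    note x' = two_row_string[OF ad' ar', folded x'_def]
    define w where "w = sigma l r (sigma (Suc l) a s)"
    define w' where "w' = sigma l (shift a) (sigma (Suc l) a' s)"
    have epsw: "eps (Suc l) w = a 1" using IH(1) by (simp only: w_def)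
    have w: "eps (Suc l) w' = a 1 + (if k \<le> Suc l then 1 else 0) \<and> etop (Suc l) w' = etop (Suc l) w"
    proof (cases "k \<le> Suc l")
      case True
      have "(w, w') \<in> arcs K (Suc l)" unfolding w_def w'_def by (rule IH(2)[OF True])
      then have "eps (Suc l) w' = Suc (eps (Suc l) w)" "w = e (Suc l) w'"
        using arc_lengths(1) arc_iff_e by auto
      then show ?thesis using True epsw etop_e[of "Suc l" w'] by simp
    next
      case False
      have "sigma (Suc l) a' s = sigma (Suc l) a s" 
        by (rule sigma_cong) (use False in \<open>auto simp: a'_def\<close>)
      moreover have "sigma l (shift a) (sigma (Suc l) a s) = sigma l r (sigma (Suc l) a s)"
        by (rule sigma_cong) (use False in \<open>auto simp: r_def\<close>)
      ultimately have "w' = w" by (simp only: w_def w'_def)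
      then show ?thesis using False epsw by simp
    qed
    note x = x[folded w_def] and x' = x'[folded w'_def]
    have "eps (Suc (Suc l)) x' = Suc (a 1) \<and> eps (Suc l) (etop (Suc (Suc l)) x') = eps (Suc l) (etop (Suc (Suc l)) x) \<and>
      eps (Suc (Suc l)) (etop (Suc l) (etop (Suc (Suc l)) x')) = eps (Suc (Suc l)) (etop (Suc l) (etop (Suc (Suc l)) x))"
    proof (cases "k \<le> Suc l")
      case True
      then show ?thesis
        using x(1) x'(1) w R[of "Suc l"] R'[of "Suc l"] L'[of "Suc (Suc l)"] k epsx
        unfolding tropical_def by simp linarith
    next
      case False
      then show ?thesis
        using x(1) x'(1) w R[of "Suc l"] R'[of "Suc l"] L'[of "Suc (Suc l)"] k epsx
        unfolding tropical_def by simp linarith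
    qed
    then show "(x, x') \<in> arcs K (Suc (Suc l))"
      using x(2) x'(2) w epsx eps_etop_inj arc_from_string by metis
  qed
qed

lemma single_valued_arcs: "single_valued (arcs K i)"
  by (rule single_valuedI) (rule arc_fun)

lemma single_valued_S_op: "single_valued (S_op K m k)"
  unfolding S_op_def w_op_def
  by (intro single_valued_apply_in_order) (auto intro!: single_valued_apply_in_order single_valued_arcs)

lemma S_op_pvertex:
  assumes "admissible m a s" "k \<in> {1..m}" "a k < phi k s" "\<And>i. k < i \<Longrightarrow> i \<le> m \<Longrightarrow> a i = 0"
  shows "(pvertex m a s, pvertex m (a(k := Suc (a k))) s) \<in> S_op K m k"
  using assms
proof (induction m arbitrary: a s k rule: less_induct)
  case (less M)
  then obtain m where M: "M = Suc m" by (cases M) auto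
  define a' where "a' = a(k := Suc (a k))"
  define r where "r = (shift a)(k := Suc (shift a k))"
  define y where "y = sigma M a s"
  define y' where "y' = sigma M a' s"
  have ad: "admissible M a s" by fact
  have ad': "admissible M a' s" using less.prems by (auto simp: admissible_def a'_def)
  have ar: "admissible m r y" unfolding y_def M
    using less.prems M by (intro sigma_admissible) (auto simp: r_def shift_def admissible_def Suc_le_eq)
  have ay: "admissible m (shift a) y" unfolding y_def M
    using less.prems M by (intro sigma_admissible) (auto simp: shift_def admissible_def)
  have ay': "admissible m (shift a) y'" unfolding y'_def M
  proof (intro sigma_admissible ad'[unfolded M])
    fix i assume "i \<in> {1..m}"
    then have "a' i \<le> phi i s" "shift a i \<le> a' (Suc i)"
      using ad' M by (auto simp: admissible_def a'_def shift_def)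
    then show "shift a i + a' i \<le> phi i s + a' (Suc i)" by simp
  qed
  have arc: "(sigma m r y, sigma m (shift a) y') \<in> arcs K M"
    using two_row_arc[of m a s k] less.prems M by (simp add: r_def y_def y'_def a'_def del: sigma.simps)
  have phi': "phi i y' + a' i = phi i s + a' (Suc i)" if "i \<in> {1..m}" for i
    unfolding y'_def M by (rule sigma_phi) (use ad' M that in auto)
  have "(pvertex M a s, pvertex M a' s) \<in> S_op K M k"
  proof (cases m)
    case 0
    then have "k = 1" using less.prems M by simp
    then show ?thesis using arc 0 M S_op_self[of 1 K] by (simp add: y_def y'_def w_op_Suc del: sigma.simps(2))
  next
    case (Suc l)
    have G: "pvertex M b t = pvertex l (shift (shift b)) (sigma m (shift b) (sigma M b t))" for b t
      by (simp add: M Suc del: sigma.simps)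
    define z where "z = sigma m r y"
    define z' where "z' = sigma m (shift a) y'"
    have arcl: "(pvertex l b z, pvertex l b z') \<in> arcs K M" for b
      by (rule pvertex_arc_far) (use arc M Suc in \<open>simp_all add: z_def z'_def\<close>)
    have Gy': "pvertex m (shift a) y' = pvertex l (shift (shift a)) z'"
      by (simp add: Suc z'_def del: sigma.simps)
    have Gr: "pvertex m r y = pvertex l (shift r) z"
      by (simp add: Suc z_def del: sigma.simps)
    have lessm: "m < M" "l < M" using M Suc by simp_all
    show ?thesis
    proof (cases "k = M")
      case True
      have "sigma m (shift a) y = z"
        unfolding z_def by (rule sigma_cong) (use True M in \<open>auto simp: r_def\<close>)
      then have "(pvertex M a s, pvertex m (shift a) y') \<in> arcs K M"
        using arcl Gy' by (simp add: G y_def)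
      moreover have "shift a m < phi m y'"
      proof -
        have "a m \<le> phi m s" using ad M Suc by (simp add: admissible_def)
        then show ?thesis using phi'[of m] True M Suc by (simp add: a'_def shift_def)
      qed
      then have "(pvertex m (shift a) y', pvertex m ((shift a)(m := Suc (shift a m))) y') \<in> S_op K m m"
        using ay' Suc by (intro less.IH lessm) auto
      moreover have "(shift a)(m := Suc (shift a m)) = shift a'"
        using True M by (auto simp: a'_def shift_def)
      moreover have "S_op K M M = arcs K M O S_op K m m"
        using M Suc by (simp add: S_op_self w_op_Suc)
      ultimately have "(pvertex M a s, pvertex m (shift a') y') \<in> S_op K M k"
        using True by (auto intro: relcompI)
      then show ?thesis by (simp add: M y'_def del: sigma.simps)
    next
      case False
      then have k: "k \<le> m" "1 \<le> k" using less.prems M by auto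
      then obtain k' where k': "k = Suc k'" by (cases k) auto
      have "(pvertex m (shift a) y, pvertex m r y) \<in> S_op K m k"
        unfolding r_def
      proof (intro less.IH lessm ay)
        show "shift a k < phi k y"
          using k less.prems(3) sigma_phi[OF ad[unfolded M], of k] by (simp add: shift_def y_def M del: sigma.simps)
        show "shift a i = 0" if "k < i" "i \<le> m" for i
          using less.prems(4) that M by (simp add: shift_def)
      qed (use k in simp)
      moreover have "(pvertex m r y, pvertex l (shift r) z') \<in> arcs K M"
        using arcl Gr by simp
      moreover have "(pvertex l (shift r) z', pvertex m (shift a') y') \<in> w_op K k' (m + 2 - k)"
      proof (cases "k' = 0")
        case True
        have "pvertex m (shift a') y' = pvertex m (shift a) y'"
          by (rule pvertex_cong) (use True k' in \<open>auto simp: a'_def shift_def\<close>)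
        also have "\<dots> = pvertex l (shift r) z'"
          unfolding Gy' by (rule pvertex_cong) (use True k' in \<open>auto simp: r_def shift_def\<close>)
        finally show ?thesis using True by simp
      next
        case False
        then have k'l: "k' \<in> {1..l}" "k' \<in> {1..m}" using k k' Suc by auto
        have up: "shift a' = (shift a)(k' := Suc (shift a k'))" "shift r = (shift (shift a))(k' := Suc (shift (shift a) k'))"
          by (auto simp: a'_def r_def shift_def k')
        have "a k' \<le> phi k' s" using ad k'l M by (auto simp: admissible_def)
        then have "shift a k' < phi k' y'"
          using phi'[OF k'l(2)] by (simp add: a'_def shift_def k')
        have "(pvertex m (shift a) y', pvertex m (shift a') y') \<in> S_op K m k'"
          unfolding up
        proof (intro less.IH lessm ay' k'l \<open>shift a k' < phi k' y'\<close>)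
          show "shift a i = 0" if "k' < i" "i \<le> m" for i
            using less.prems(4) that M k' by (simp add: shift_def)
        qed
        moreover have "(pvertex l (shift (shift a)) z', pvertex l (shift r) z') \<in> S_op K l k'"
          unfolding up
        proof (intro less.IH lessm k'l)
          have ay'': "admissible (Suc l) (shift a) y'" using ay' Suc by simp
          show "admissible l (shift (shift a)) z'"
            unfolding z'_def Suc using ay'' by (intro sigma_admissible) (auto simp: shift_def admissible_def)
          show "shift (shift a) k' < phi k' z'"
            using sigma_phi[OF ay'' k'l(1)] \<open>shift a k' < phi k' y'\<close>
            by (simp add: z'_def Suc shift_def del: sigma.simps)
          show "shift (shift a) i = 0" if "k' < i" "i \<le> l" for i
            using less.prems(4) that M Suc k' by (simp add: shift_def)
        qed
        moreover have "S_op K m k' = S_op K l k' O w_op K k' (m + 2 - k)"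
          using S_op_Suc[of k' l K] k'l Suc k' by simp
        ultimately obtain x where x: "(pvertex l (shift (shift a)) z', x) \<in> S_op K l k'"
            "(x, pvertex m (shift a') y') \<in> w_op K k' (m + 2 - k)"
            and "(pvertex l (shift (shift a)) z', pvertex l (shift r) z') \<in> S_op K l k'"
          unfolding Gy' by blast
        then have "x = pvertex l (shift r) z'" using single_valuedD[OF single_valued_S_op] by blast
        then show ?thesis using x(2) by simp
      qed
      moreover have "S_op K M k = S_op K m k O arcs K M O w_op K k' (m + 2 - k)"
        using S_op_Suc[OF k(1)] k M k' by (simp add: w_op_Suc)
      ultimately have "(pvertex m (shift a) y, pvertex m (shift a') y') \<in> S_op K M k"
        by (auto intro: relcompI)
      then show ?thesis by (simp add: M y_def y'_def del: sigma.simps)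
    qed
  qed
  then show ?case by (simp only: a'_def)
qed

lemma pvertex_zero: "(\<And>i. i \<in> {1..m} \<Longrightarrow> a i = 0) \<Longrightarrow> pvertex m a s = s"
proof (induction m arbitrary: a s)
  case (Suc m)
  have "sigma k a s = s" if "k \<le> Suc m" for k
    using that by (induction k) (use Suc.prems in \<open>auto simp: prefix_sum_def\<close>)
  moreover have "pvertex m (shift a) t = t" for t
    by (rule Suc.IH) (use Suc.prems in \<open>simp add: shift_def\<close>)
  ultimately show ?case by (simp del: sigma.simps)
qed simp

lemma pvertex_chain:
  assumes "admissible m a s"
  shows "(s, pvertex m a s) \<in> apply_in_order (map (\<lambda>k. S_op K m k ^^ a k) [1..<m + 1])"
proof -
  define b where "b j = (\<lambda>i. if i \<le> j then a i else 0)" for j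
  have "(s, pvertex m (b j) s) \<in> apply_in_order (map (\<lambda>k. S_op K m k ^^ a k) [1..<j + 1])"
    if "j \<le> m" for j
    using that
  proof (induction j)
    case 0
    have "pvertex m (b 0) s = s" by (rule pvertex_zero) (simp add: b_def)
    then show ?case by simp
  next
    case (Suc j)
    let ?k = "Suc j"
    have "(pvertex m (b j) s, pvertex m ((b j)(?k := t)) s) \<in> S_op K m ?k ^^ t" if "t \<le> a ?k" for t
      using that
    proof (induction t)
      case 0
      have "(b j)(?k := 0) = b j" by (auto simp: b_def)
      then show ?case by simp
    next
      case (Suc t)
      have "(pvertex m ((b j)(?k := t)) s, pvertex m (((b j)(?k := t))(?k := Suc (((b j)(?k := t)) ?k))) s) \<in> S_op K m ?k"
      proof (rule S_op_pvertex)
        have le: "a ?k \<le> phi ?k s" using assms \<open>Suc j \<le> m\<close> by (simp add: admissible_def)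
        then have "t \<le> phi ?k s" using Suc.prems by simp
        then show "admissible m ((b j)(?k := t)) s"
          using assms by (auto simp: admissible_def b_def)
        show "((b j)(?k := t)) ?k < phi ?k s" using le Suc.prems by simp
        show "?k \<in> {1..m}" using \<open>Suc j \<le> m\<close> by simp
        show "((b j)(?k := t)) i = 0" if "?k < i" for i using that by (simp add: b_def)
      qed
      then have "(pvertex m ((b j)(?k := t)) s, pvertex m ((b j)(?k := Suc t)) s) \<in> S_op K m ?k"
        by simp
      then show ?case using Suc.IH Suc.prems by (auto intro: relcompI simp del: fun_upd_apply)
    qed
    from this[of "a ?k"] have "(pvertex m (b j) s, pvertex m ((b j)(?k := a ?k)) s) \<in> S_op K m ?k ^^ a ?k"
      by (simp del: fun_upd_apply)
    moreover have "(b j)(?k := a ?k) = b ?k" by (auto simp: b_def le_Suc_eq)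
    ultimately show ?case using Suc by (auto intro: relcompI)
  qed
  moreover have "pvertex m (b m) s = pvertex m a s" by (rule pvertex_cong) (simp add: b_def)
  ultimately show ?thesis by fastforce
qed

subsection \<open>String parametrizations and lower sources\<close>

fun tops :: "nat list \<Rightarrow> 'v \<Rightarrow> 'v" where
  "tops [] u = u"
| "tops (i # is) u = tops is (etop i u)"

fun strs :: "nat list \<Rightarrow> 'v \<Rightarrow> nat list" where
  "strs [] u = []"
| "strs (i # is) u = eps i u # strs is (etop i u)"

lemma tops_append [simp]: "tops (is @ js) u = tops js (tops is u)"
  by (induction "is" arbitrary: u) auto

lemma strs_append [simp]: "strs (is @ js) u = strs is u @ strs js (tops is u)"
  by (induction "is" arbitrary: u) auto

lemma far_tops:
  assumes "\<And>j. j \<in> set js \<Longrightarrow> far i j"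
  shows "etop i (tops js u) = tops js (etop i u)" "eps i (tops js u) = eps i u" "strs js (etop i u) = strs js u"
proof -
  have "etop i (tops js u) = tops js (etop i u) \<and> eps i (tops js u) = eps i u \<and> strs js (etop i u) = strs js u"
    using assms
  proof (induction js arbitrary: u)
    case (Cons j js)
    then have far: "far i j" by simp
    then show ?case
      using Cons etop_far_commute[OF far, of u, symmetric] far_etop[OF far, of u] far_etop[OF far_sym[OF far], of u] by auto
  qed auto
  then show "etop i (tops js u) = tops js (etop i u)" "eps i (tops js u) = eps i u" "strs js (etop i u) = strs js u"
    by auto
qed

text \<open>
  The word \<open>k \<dots> N - 1, N, N - 1 \<dots> k\<close> is turned into \<open>N \<dots> k + 1, k, k + 1 \<dots> N\<close> by one braid move
  for each color, from the middle outwards; only the second half of the new string is recorded.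
\<close>

lemma two_row_transition:
  fixes \<mu> L g :: "nat \<Rightarrow> nat"
  assumes "1 \<le> k" "k \<le> N" "N \<le> n"
    and "strs ([k..<N] @ rev [k..<Suc N]) z = map \<mu> [k..<N] @ map L (rev [k..<Suc N])"
    and g: "g N = L N" "\<And>i. i < N \<Longrightarrow> g i = \<mu> i + L i"
  shows "strs [k..<Suc N] (tops (rev [Suc k..<Suc N]) z) =
      g k # map (\<lambda>i. min (\<mu> (i - 1)) (g i - L (i - 1))) [Suc k..<Suc N] \<and>
    tops [k..<Suc N] (tops (rev [Suc k..<Suc N]) z) = tops ([k..<N] @ rev [k..<Suc N]) z"
  using assms(2,1,4)
proof (induction k arbitrary: z rule: inc_induct)
  case base
  then show ?case using g by simp
next
  case (step k)
  define k' where "k' = Suc k"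
  define js where "js = [Suc k'..<Suc N]"
  define Q where "Q i = min (\<mu> (i - 1)) (g i - L (i - 1))" for i
  have kN: "k < N" by fact
  have w: "[k..<N] = k # [k'..<N]" "[k..<Suc N] = k # [k'..<Suc N]" "[k'..<Suc N] = k' # js"
    using kN by (simp_all add: k'_def js_def upt_conv_Cons del: upt_Suc)
  define z1 where "z1 = etop k z"
  define s1 where "s1 = tops ([k'..<N] @ rev [k'..<Suc N]) z1"
  have "eps k z # strs ([k'..<N] @ rev [k'..<Suc N]) z1 @ [eps k s1] =
      \<mu> k # (map \<mu> [k'..<N] @ map L (rev [k'..<Suc N])) @ [L k]"
    using step.prems(2) unfolding w(1,2) z1_def s1_def by (simp del: upt_Suc)
  then have z: "eps k z = \<mu> k" "eps k s1 = L k"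
    "strs ([k'..<N] @ rev [k'..<Suc N]) z1 = map \<mu> [k'..<N] @ map L (rev [k'..<Suc N])"
    by (simp_all del: upt_Suc append_assoc strs_append)
  define y1 where "y1 = tops (rev js) z1"
  have "strs [k'..<Suc N] y1 = g k' # map Q js \<and> tops [k'..<Suc N] y1 = s1"
    using step.IH[OF _ z(3)[unfolded k'_def]] step.prems(1)
    unfolding s1_def y1_def js_def Q_def k'_def by (simp del: upt_Suc)
  then have IH: "strs (k' # js) y1 = g k' # map Q js" "tops (k' # js) y1 = s1"
    unfolding w(3) by blast+
  have far: "\<And>j. j \<in> set js \<Longrightarrow> far k j" "\<And>j. j \<in> set (rev js) \<Longrightarrow> far k j"
    by (auto simp: js_def k'_def far_def neighbors_def)
  define y' where "y' = tops (rev js) z"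
  have y': "etop k y' = y1" "eps k y' = \<mu> k"
    unfolding y'_def y1_def z1_def 
    using far_tops(1)[of "rev js" k z, OF far(2)] far_tops(2)[of "rev js" k z, OF far(2)] z(1) by simp_all
  define y2 where "y2 = etop k' y1"
  have y2: "eps k' y1 = g k'" "strs js y2 = map Q js" "tops js y2 = s1"
    using IH by (simp_all add: y2_def)
  then have e2: "eps k y2 = L k" using far_tops(2)[of js k y2, OF far(1)] z(2) by simp
  define y where "y = etop k' y'"
  have "A2 k k' y'" using step.prems(1) kN assms(3) by (intro A2_rule) (auto simp: k'_def neighbors_def)
  then have "tropical (\<mu> k) (g k') (L k) (eps k' y') (eps k y) (eps k' (etop k y))" "etop k' (etop k y) = etop k y2"
    by (simp_all add: A2_def y' y2 e2 y_def[symmetric] y2_def[symmetric])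
  then have y: "eps k y = g k" "eps k' (etop k y) = Q k'" "etop k' (etop k y) = etop k y2"
    using tropical_min g(2)[OF kN] by (auto simp: Q_def k'_def)
  have "tops (rev [Suc k..<Suc N]) z = y"
    unfolding k'_def[symmetric] w(3) by (simp add: y_def y'_def)
  moreover have "strs [k..<Suc N] y = g k # map Q [k'..<Suc N]"
    unfolding w(2,3) using y y2(2) far_tops(3)[of js k y2, OF far(1)] by simp
  moreover have "tops [k..<Suc N] y = etop k s1"
    unfolding w(2,3) using y y2(3) far_tops(1)[of js k y2, OF far(1)] by simp
  moreover have "tops ([k..<N] @ rev [k..<Suc N]) z = etop k s1"
    unfolding w(1,2) s1_def z1_def by simp
  ultimately show ?case unfolding Q_def k'_def by simp
qed

lemma source_extend:
  assumes "1 \<le> k" "k \<le> Suc N" "N \<le> n" "is_source {k..<N} z"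
  shows "is_source {k..N} (tops (rev [k..<Suc N]) z)"
proof -
  have "(\<forall>i. j \<le> i \<and> i \<le> N \<or> k \<le> i \<and> Suc i < j \<longrightarrow> eps i (tops (rev [j..<Suc N]) z) = 0) \<and>
      (j \<le> N \<longrightarrow> (\<forall>i. k \<le> i \<and> i < j \<longrightarrow> eps i (tops (rev [Suc j..<Suc N]) z) = 0))"
    if "k \<le> j" "j \<le> Suc N" for j
    using that(2,1)
  proof (induction j rule: inc_induct)
    case base
    then show ?case using assms(4) by (auto simp: is_source_def)
  next
    case (step i)
    let ?u = "tops (rev [Suc i..<Suc N]) z"
    have top: "tops (rev [i..<Suc N]) z = etop i ?u"
      using step.hyps by (simp add: upt_conv_Cons del: upt_Suc)
    have IH: "\<forall>l. Suc i \<le> l \<and> l \<le> N \<or> k \<le> l \<and> l < i \<longrightarrow> eps l ?u = 0"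
      "Suc i \<le> N \<Longrightarrow> eps i (tops (rev [Suc (Suc i)..<Suc N]) z) = 0"
      using step by auto
    have "eps l (etop i ?u) = 0" if l: "i \<le> l \<and> l \<le> N \<or> k \<le> l \<and> Suc l < i" for l
    proof -
      consider "l = i" | "far i l" | "l = Suc i" "Suc i \<le> N" 
        using l by (cases "l = i"; cases "l = Suc i") (auto simp: far_def neighbors_def)
      then show ?thesis
      proof cases
        case 2
        then show ?thesis using IH(1) l far_etop[OF 2] by (auto simp: far_def)
      next
        case 3
        let ?x = "tops (rev [Suc (Suc i)..<Suc N]) z"
        have "A2 i (Suc i) ?x"
          using step 3 assms(1,3) by (intro A2_rule) (auto simp: neighbors_def)
        then have "etop (Suc i) (etop i (etop (Suc i) ?x)) = etop i (etop (Suc i) ?x)"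
          using IH(2)[OF 3(2)] by (simp add: A2_def etop_eq_self)
        moreover have "?u = etop (Suc i) ?x" using 3 by (simp add: upt_conv_Cons del: upt_Suc)
        ultimately show ?thesis using eps_etop 3 by metis
      qed (simp add: eps_etop)
    qed
    then show ?case unfolding top using IH(1) by auto
  qed
  then show ?thesis using assms by (auto simp: is_source_def)
qed

lemma sigma_strs:
  assumes "admissible m a s" "k \<le> m"
  shows "strs (rev [1..<Suc k]) (sigma k a s) = map (prefix_sum a) (rev [1..<Suc k]) \<and>
    tops (rev [1..<Suc k]) (sigma k a s) = s"
  using assms(2)
proof (induction k)
  case (Suc k)
  have "[1..<Suc (Suc k)] = [1..<Suc k] @ [Suc k]" by simp
  then show ?case
    using Suc sigma_string[OF assms(1) Suc.prems] by (simp del: upt_Suc sigma.simps)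
qed simp

lemma f_component: "i \<in> I \<Longrightarrow> f i v \<in> component K I v"
  by (cases "phi i v = 0") (simp_all add: f_eq_self component_refl component_arc[OF f_arc])

lemma fpow_component: "i \<in> I \<Longrightarrow> (f i ^^ t) v \<in> component K I v"
proof (induction t)
  case (Suc t)
  then show ?case using component_trans[OF Suc.IH f_component[of i I]] by simp
qed (simp add: component_refl)

lemma etop_component: "i \<in> I \<Longrightarrow> etop i v \<in> component K I v"
  by (rule component_sym, rule above_component, rule etop_above_in)

lemma tops_component: "set is \<subseteq> I \<Longrightarrow> tops is v \<in> component K I v"
proof (induction "is" arbitrary: v)
  case (Cons i "is")
  then show ?case using component_trans[OF etop_component[of i I v] Cons.IH] by simp
qed (simp add: component_refl)

lemma sigma_component: "sigma m a s \<in> component K {1..m} s"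
proof (induction m)
  case (Suc m)
  have "sigma m a s \<in> component K {1..Suc m} s"
    by (rule component_mono[OF _ Suc.IH]) auto
  then show ?case unfolding sigma.simps by (rule component_trans) (rule fpow_component, simp)
qed (simp add: component_refl)

lemma pvertex_component: "pvertex m a s \<in> component K {1..m} s"
proof (induction m arbitrary: a s)
  case (Suc m)
  have "pvertex m (shift a) (sigma (Suc m) a s) \<in> component K {1..Suc m} (sigma (Suc m) a s)"
    by (rule component_mono[OF _ Suc.IH]) auto
  then show ?case using component_trans[OF sigma_component] by (simp del: sigma.simps)
qed (simp add: component_refl)

text \<open>
  The row \<open>\<lambda>\<close>-to-\<open>\<mu>\<close> data \<open>a\<close> and \<open>\<mu>\<close>-to-\<open>\<kappa>\<close> data \<open>p\<close> of a Gelfand-Tsetlin pattern determine the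
  position of the lower subcrystal; this is a Bender-Knuth toggle.
\<close>

lemma lower_source_of:
  assumes "admissible (Suc m) a s" "is_source {2..m} x"
    and "strs [1..<Suc m] x = map (suffix_sum p m) [1..<Suc m]" "tops [1..<Suc m] x = sigma (Suc m) a s"
  obtains y where "y \<in> component K {2..Suc m} x" "is_source {2..Suc m} y" "tops [1..<Suc (Suc m)] y = s"
    "strs [1..<Suc (Suc m)] y =
      (suffix_sum p m 1 + a 1) # map (\<lambda>i. min (suffix_sum p m (i - 1)) (suffix_sum p m i + a i)) [2..<Suc (Suc m)]"
proof -
  let ?N = "Suc m"
  define y where "y = tops (rev [2..<Suc ?N]) x"
  define g where "g i = suffix_sum p m i + prefix_sum a i" for i
  have N: "?N \<le> n" using assms(1) by (simp add: admissible_def)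
  have str: "strs ([1..<?N] @ rev [1..<Suc ?N]) x = map (suffix_sum p m) [1..<?N] @ map (prefix_sum a) (rev [1..<Suc ?N])"
    "tops ([1..<?N] @ rev [1..<Suc ?N]) x = s"
    using assms(3,4) sigma_strs[OF assms(1), of ?N] by (simp_all del: upt_Suc sigma.simps)
  have two: "Suc 1 = 2" by simp
  have "strs [1..<Suc ?N] (tops (rev [Suc 1..<Suc ?N]) x) =
      g 1 # map (\<lambda>i. min (suffix_sum p m (i - 1)) (g i - prefix_sum a (i - 1))) [Suc 1..<Suc ?N] \<and>
    tops [1..<Suc ?N] (tops (rev [Suc 1..<Suc ?N]) x) = tops ([1..<?N] @ rev [1..<Suc ?N]) x"
    by (rule two_row_transition[OF _ _ N str(1)]) (simp_all add: g_def del: upt_Suc)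
  then have y: "strs [1..<Suc ?N] y = g 1 # map (\<lambda>i. min (suffix_sum p m (i - 1)) (g i - prefix_sum a (i - 1))) [2..<Suc ?N] \<and>
    tops [1..<Suc ?N] y = s"
    unfolding two y_def str(2) .
  have eq: "map (\<lambda>i. min (suffix_sum p m (i - 1)) (g i - prefix_sum a (i - 1))) [2..<Suc ?N] =
      map (\<lambda>i. min (suffix_sum p m (i - 1)) (suffix_sum p m i + a i)) [2..<Suc ?N]"
  proof (rule map_cong[OF refl])
    fix i assume "i \<in> set [2..<Suc ?N]"
    then have "i \<noteq> 0" by (simp del: upt_Suc)
    then obtain j where "i = Suc j" using not0_implies_Suc by blast
    then show "min (suffix_sum p m (i - 1)) (g i - prefix_sum a (i - 1)) = min (suffix_sum p m (i - 1)) (suffix_sum p m i + a i)"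
      by (simp add: g_def prefix_sum_Suc)
  qed
  have g1: "g 1 = suffix_sum p m 1 + a 1" by (simp add: g_def prefix_sum_Suc)
  have src: "is_source {2..?N} y"
    unfolding y_def by (rule source_extend) (use N assms(2) in \<open>auto simp: is_source_def\<close>)
  have comp: "y \<in> component K {2..?N} x"
    unfolding y_def by (rule tops_component) auto
  show ?thesis by (rule that[OF comp src conjunct2[OF y] conjunct1[OF y, unfolded eq g1]])
qed

lemma pvertex_lower_source:
  assumes "admissible m a s"
  obtains y where "y \<in> component K {2..m} (pvertex m a s)" "is_source {2..m} y"
    "strs [1..<Suc m] y = map (suffix_sum a m) [1..<Suc m]" "tops [1..<Suc m] y = s"
  using assms
proof (induction m arbitrary: a s thesis)
  case 0
  show ?case by (rule 0(1)[of s]) (simp_all add: component_refl is_source_def)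
next
  case (Suc m)
  have "admissible m (shift a) (sigma (Suc m) a s)"
    using Suc.prems(2) by (intro sigma_admissible) (auto simp: shift_def admissible_def)
  then obtain x where x: "x \<in> component K {2..m} (pvertex m (shift a) (sigma (Suc m) a s))" "is_source {2..m} x"
    "strs [1..<Suc m] x = map (suffix_sum (shift a) m) [1..<Suc m]" "tops [1..<Suc m] x = sigma (Suc m) a s"
    by (rule Suc.IH[rotated])
  obtain y where y: "y \<in> component K {2..Suc m} x" "is_source {2..Suc m} y" "tops [1..<Suc (Suc m)] y = s"
    "strs [1..<Suc (Suc m)] y = (suffix_sum (shift a) m 1 + a 1) #
      map (\<lambda>i. min (suffix_sum (shift a) m (i - 1)) (suffix_sum (shift a) m i + a i)) [2..<Suc (Suc m)]"
    by (rule lower_source_of[OF Suc.prems(2) x(2-4)])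
  have "x \<in> component K {2..Suc m} (pvertex (Suc m) a s)"
    using component_mono[OF _ x(1), of "{2..Suc m}"] by (simp del: sigma.simps)
  then have "y \<in> component K {2..Suc m} (pvertex (Suc m) a s)" using y(1) by (rule component_trans)
  moreover have "strs [1..<Suc (Suc m)] y = map (suffix_sum a (Suc m)) [1..<Suc (Suc m)]"
  proof -
    have "map (\<lambda>i. min (suffix_sum (shift a) m (i - 1)) (suffix_sum (shift a) m i + a i)) [2..<Suc (Suc m)] =
        map (suffix_sum a (Suc m)) [2..<Suc (Suc m)]"
    proof (rule map_cong[OF refl])
      fix i assume "i \<in> set [2..<Suc (Suc m)]"
      then have i: "i \<noteq> 0" "i \<le> Suc m" by (auto simp del: upt_Suc)
      then obtain j where "i = Suc j" using not0_implies_Suc by blast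
      then show "min (suffix_sum (shift a) m (i - 1)) (suffix_sum (shift a) m i + a i) = suffix_sum a (Suc m) i"
        using suffix_sum_Suc[of i "Suc m" a] i by (simp add: suffix_sum_shift)
    qed
    moreover have "suffix_sum (shift a) m 1 + a 1 = suffix_sum a (Suc m) 1"
      using suffix_sum_Suc[of 1 "Suc m" a] by (simp add: suffix_sum_shift)
    moreover have "[1..<Suc (Suc m)] = 1 # [2..<Suc (Suc m)]"
      using upt_conv_Cons[of 1 "Suc (Suc m)"] by (simp add: numeral_2_eq_2 del: upt_Suc)
    ultimately show ?thesis unfolding y(4) by (simp only: list.map)
  qed
  ultimately show ?case by (rule Suc.prems(1)[OF _ y(2) _ y(3)])
qed

subsection \<open>Passage to subcrystals\<close>

lemma subcrystal_self:
  assumes "v \<in> verts K"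
  shows "subcrystal K {1..n} v = K"
proof -
  have "arcs K i \<inter> verts K \<times> verts K = arcs K i" for i using arcs_verts[of i] by auto
  then have "(\<lambda>i. if i \<in> {1..n} then arcs K i \<inter> verts K \<times> verts K else {}) = arcs K"
    using arc_colors by (intro ext) presburger
  then show ?thesis unfolding subcrystal_def connected[OF assms] by simp
qed

context
  fixes H :: "'v cgraph" and m :: nat and v s :: 'v
  assumes m: "m \<le> n" and H: "H = subcrystal K {1..m} v"
    and s: "s \<in> component K {1..m} v" "is_source {1..m} s"
begin

lemma agree_arcs: "i \<in> {1..m} \<Longrightarrow> agree (component K {1..m} v) (arcs H i) (arcs K i)"
proof -
  assume i: "i \<in> {1..m}"
  have "y \<in> component K {1..m} v" if "x \<in> component K {1..m} v" "(x, y) \<in> arcs K i" for x y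
    using component_trans[OF that(1) component_arc[OF that(2) i]] .
  then show ?thesis using i by (auto simp: agree_def H subcrystal_def)
qed

lemma source_subcrystal: "source H = s"
  unfolding source_def
proof (rule the_equality)
  have "(u, s) \<notin> arcs H i" for u i
    using s(2) eps_pos_iff[of i s] by (auto simp: H subcrystal_def is_source_def)
  then show "s \<in> verts H \<and> (\<forall>i u. (u, s) \<notin> arcs H i)"
    using s(1) by (simp add: H subcrystal_def)
next
  fix x assume x: "x \<in> verts H \<and> (\<forall>i u. (u, x) \<notin> arcs H i)"
  then have xv: "x \<in> component K {1..m} v" by (simp add: H subcrystal_def)
  have "is_source {1..m} x"
    unfolding is_source_def
  proof (intro ballI, rule ccontr)
    fix i assume i: "i \<in> {1..m}" "eps i x \<noteq> 0"
    then have arc: "(e i x, x) \<in> arcs K i" by (simp add: e_arc)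
    have "e i x \<in> component K {1..m} v"
      by (rule component_trans[OF xv component_sym[OF component_arc[OF arc i(1)]]])
    then have "(e i x, x) \<in> arcs H i" using arc xv i by (simp add: H subcrystal_def)
    then show False using x by blast
  qed
  moreover have "x \<in> component K {1..m} s" by (rule component_trans[OF component_sym[OF s(1)] xv])
  ultimately show "x = s" using component_source_unique[of x "{1..m}" s] s(2) by simp
qed

lemma parameter_subcrystal: "i \<in> {1..m} \<Longrightarrow> parameter H i = phi i s"
  unfolding parameter_def source_subcrystal head_len_def
  using agree_relpow[OF agree_arcs[of i]] s(1) by (simp add: agree_def)

lemma box_admissible:
  "a \<in> box m (parameter H) \<Longrightarrow> admissible m (\<lambda>i. nat (a i)) s"
  using parameter_subcrystal m s(2) by (auto simp: box_def admissible_def)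

lemma principal_vertex_subcrystal:
  assumes "a \<in> box m (parameter H)"
  shows "principal_vertex H m a = pvertex m (\<lambda>i. nat (a i)) s"
proof -
  have ag: "agree (component K {1..m} v)
      (apply_in_order (map (\<lambda>k. S_op H m k ^^ nat (a k)) [1..<m + 1]))
      (apply_in_order (map (\<lambda>k. S_op K m k ^^ nat (a k)) [1..<m + 1]))"
    by (intro agree_apply_in_order agree_relpow agree_S_op agree_arcs) auto
  have "single_valued (S_op K m k ^^ t)" for k t
    by (induction t) (simp_all add: single_valued_relcomp single_valued_S_op)
  then have sv: "single_valued (apply_in_order (map (\<lambda>k. S_op K m k ^^ nat (a k)) [1..<m + 1]))"
    by (intro single_valued_apply_in_order) auto
  show ?thesis
    unfolding principal_vertex_def source_subcrystal
  proof (rule the_equality)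
    show "(s, pvertex m (\<lambda>i. nat (a i)) s) \<in> apply_in_order (map (\<lambda>k. S_op H m k ^^ nat (a k)) [1..<m + 1])"
      using ag s(1) pvertex_chain[OF box_admissible[OF assms]] unfolding agree_def by blast
    fix x assume "(s, x) \<in> apply_in_order (map (\<lambda>k. S_op H m k ^^ nat (a k)) [1..<m + 1])"
    then have "(s, x) \<in> apply_in_order (map (\<lambda>k. S_op K m k ^^ nat (a k)) [1..<m + 1])"
      using ag s(1) unfolding agree_def by blast
    then show "x = pvertex m (\<lambda>i. nat (a i)) s"
      using pvertex_chain[OF box_admissible[OF assms]] single_valuedD[OF sv] by blast
  qed
qed

end

end

theorem theorem3:
  fixes K :: "'v cgraph" and n :: nat and c :: "nat \<Rightarrow> nat"
    and a b h \<Delta> :: "nat \<Rightarrow> int" and v :: 'v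
  assumes "n \<ge> 2"
    and "A_crystal_with n c K"
    and "a \<in> box n c"
    and "is_coordinate (upper K n a) (n - 1) h (principal_vertex K n a)"
    and "is_coordinate (upper K n a) (n - 1) (\<lambda>i. h i + \<Delta> i) v"
    and "b \<in> box n c"
    and "contained_in (subcrystal K {2..n - 1} v) (lower K n b)"
    and "\<Delta> 0 = 0" and "\<Delta> n = 0"
  shows "\<forall>i\<in>{1..n}. b i = a i + max 0 (\<Delta> i) + min 0 (\<Delta> (i - 1))"
proof -
  interpret A_crystal n K using assms(2) by (simp add: A_crystal_with_def)
  obtain m where n: "n = Suc m" "1 \<le> m" using assms(1) by (cases n) auto
  obtain v0 where v0: "v0 \<in> verts K" using nonempty by blast
  obtain s where s: "(s, v0) \<in> (\<Union>i\<in>{1..n}. arcs K i)\<^sup>*" "is_source {1..n} s"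
    using source_above_exists by blast
  have "s \<in> component K {1..n} v0" using component_sym[OF above_component[OF s(1)]] .
  note sub = subcrystal_self[OF v0, symmetric] this s(2)
  have boxes: "a \<in> box n (parameter K)" "b \<in> box n (parameter K)"
    using assms(2,3,6) by (auto simp: box_def A_crystal_with_def)
  define a' where "a' i = nat (a i)" for i
  define b' where "b' i = nat (b i)" for i
  have adm: "admissible (Suc m) a' s" "admissible (Suc m) b' s"
    using box_admissible[OF order_refl sub] boxes unfolding a'_def b'_def n by blast+
  have pa: "principal_vertex K n a = pvertex (Suc m) a' s" and pb: "principal_vertex K n b = pvertex (Suc m) b' s"
    using principal_vertex_subcrystal[OF order_refl sub] boxes unfolding a'_def b'_def n by blast+
  define t where "t = sigma (Suc m) a' s"
  have t: "is_source {1..m} t" using sigma_source[OF adm(1), of "Suc m"] by (simp add: t_def)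
  have pat: "pvertex (Suc m) a' s = pvertex m (shift a') t" by (simp add: t_def)
  have up: "upper K n a = subcrystal K {1..m} (pvertex (Suc m) a' s)"
    unfolding upper_def pa by (simp add: n del: pvertex.simps)
  have "t \<in> component K {1..m} (pvertex (Suc m) a' s)"
    unfolding pat by (rule component_sym) (rule pvertex_component)
  note sub' = up this t
  have mn: "m \<le> n" by (simp add: n)
  define h' where "h' i = nat (h i)" for i
  define p where "p i = nat (h i + \<Delta> i)" for i
  have boxes': "h \<in> box m (parameter (upper K n a))" "(\<lambda>i. h i + \<Delta> i) \<in> box m (parameter (upper K n a))"
    and pv: "principal_vertex (upper K n a) m h = pvertex (Suc m) a' s"
      "principal_vertex (upper K n a) m (\<lambda>i. h i + \<Delta> i) = v"
    using assms(4,5) by (simp_all add: is_coordinate_def n pa[unfolded n])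
  have adm': "admissible m h' t" "admissible m p t"
    using box_admissible[OF mn sub'] boxes' unfolding h'_def p_def by blast+
  have ph: "pvertex m h' t = pvertex m (shift a') t" and pp: "pvertex m p t = v"
    using principal_vertex_subcrystal[OF mn sub'] boxes' pv unfolding h'_def p_def pat by auto
  have adms: "admissible m (shift a') t"
    unfolding t_def using adm(1) by (intro sigma_admissible) (auto simp: shift_def admissible_def)

  have h: "h' i = a' (Suc i)" if i: "i \<in> {1..m}" for i
  proof -
    obtain x where x: "x \<in> component K {2..m} (pvertex m h' t)" "is_source {2..m} x"
      "strs [1..<Suc m] x = map (suffix_sum h' m) [1..<Suc m]"
      by (rule pvertex_lower_source[OF adm'(1)])
    obtain y where y: "y \<in> component K {2..m} (pvertex m (shift a') t)" "is_source {2..m} y"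
      "strs [1..<Suc m] y = map (suffix_sum (shift a') m) [1..<Suc m]"
      by (rule pvertex_lower_source[OF adms])
    have "y \<in> component K {2..m} x" using component_trans[OF component_sym[OF x(1)]] y(1) ph by simp
    then have "x = y" using component_source_unique x(2) y(2) by blast
    then have "map (suffix_sum h' m) [1..<Suc m] = map (suffix_sum (shift a') m) [1..<Suc m]" using x(3) y(3) by simp
    then have eq: "suffix_sum h' m j = suffix_sum (shift a') m j" if "j \<in> {1..m}" for j using that by (simp del: upt_Suc)
    have "suffix_sum h' m (Suc i) = suffix_sum (shift a') m (Suc i)"
      using eq[of "Suc i"] i by (cases "i = m") auto
    then have "h' i = shift a' i" using eq[OF i] suffix_sum_Suc[of i m] i by simp
    then show ?thesis by (simp add: shift_def)
  qed

  obtain x where x: "x \<in> component K {2..m} (pvertex m p t)" "is_source {2..m} x"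
    "strs [1..<Suc m] x = map (suffix_sum p m) [1..<Suc m]" "tops [1..<Suc m] x = sigma (Suc m) a' s"
    unfolding t_def by (rule pvertex_lower_source[OF adm'(2)[unfolded t_def]])
  obtain y where y: "y \<in> component K {2..n} x" "is_source {2..n} y"
    "strs [1..<Suc n] y = (suffix_sum p m 1 + a' 1) # map (\<lambda>i. min (suffix_sum p m (i - 1)) (suffix_sum p m i + a' i)) [2..<Suc n]"
    unfolding n by (rule lower_source_of[OF adm(1) x(2-4)])
  obtain z where z: "z \<in> component K {2..n} (principal_vertex K n b)" "is_source {2..n} z"
    "strs [1..<Suc n] z = map (suffix_sum b' n) [1..<Suc n]"
    unfolding pb unfolding n by (rule pvertex_lower_source[OF adm(2)])
  have "v \<in> component K {2..n} (principal_vertex K n b)"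
    using assms(7) component_refl[where v = v and I = "{2..n - 1}"] by (auto simp: contained_in_def lower_def subcrystal_def)
  moreover have "x \<in> component K {2..n} v"
    using component_mono[OF _ x(1), of "{2..n}"] by (simp add: pp n)
  ultimately have "y \<in> component K {2..n} z"
    using component_trans component_sym y(1) z(1) by meson
  then have "y = z" using component_source_unique y(2) z(2) by blast
  then have str: "map (suffix_sum b' n) [1..<Suc n] =
      (suffix_sum p m 1 + a' 1) # map (\<lambda>i. min (suffix_sum p m (i - 1)) (suffix_sum p m i + a' i)) [2..<Suc n]"
    using y(3) z(3) by simp
  have "[1..<Suc n] = 1 # [2..<Suc n]"
    using upt_conv_Cons[of 1 "Suc n"] n by (simp add: numeral_2_eq_2 del: upt_Suc)
  then have B1: "suffix_sum b' n 1 = suffix_sum p m 1 + a' 1"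
    and B2: "\<And>i. i \<in> {2..n} \<Longrightarrow> suffix_sum b' n i = min (suffix_sum p m (i - 1)) (suffix_sum p m i + a' i)"
    using str by (simp_all del: upt_Suc)
  have \<Delta>: "int (p i) = \<Delta> i + int (a' (Suc i))" if "i \<in> {1..m}" for i
  proof -
    have "0 \<le> h i" "0 \<le> h i + \<Delta> i" using boxes' that by (simp_all add: box_def)
    then show ?thesis using h[OF that] by (simp add: h'_def p_def)
  qed
  have B: "int (suffix_sum b' n i) = int (suffix_sum p m i) + int (a' i) + min 0 (\<Delta> (i - 1))" if i: "i \<in> {1..n}" for i
  proof (cases "i = 1")
    case True
    then show ?thesis using B1 assms(8) by simp
  next
    case False
    then obtain j where j: "i = Suc j" "j \<in> {1..m}" using i n by (cases i) auto
    then show ?thesis using B2[of i] \<Delta>[OF j(2)] suffix_sum_Suc[of j m p] n by simp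
  qed
  show ?thesis
  proof
    fix i assume i: "i \<in> {1..n}"
    have ab: "a i = int (a' i)" "b i = int (b' i)" using boxes i by (auto simp: a'_def b'_def box_def)
    have bi: "suffix_sum b' n i = b' i + suffix_sum b' n (Suc i)" using suffix_sum_Suc[of i n b'] i by simp
    show "b i = a i + max 0 (\<Delta> i) + min 0 (\<Delta> (i - 1))"
    proof (cases "i = n")
      case True
      then show ?thesis using B[OF i] bi ab assms(9) n by simp
    next
      case False
      then have j: "i \<in> {1..m}" "Suc i \<in> {1..n}" using i n by auto
      then show ?thesis
        using B[OF i] B[OF j(2)] bi ab \<Delta>[OF j(1)] suffix_sum_Suc[of i m p] by simp
    qed
  qed
qed

end
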